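(* Let $\bullet$ be nothing, "$\leq 1$" or "$1$". For every proper map $r \colon X \to Y$ between topological spaces, $\mathbf V r \colon \mathbf V_\bullet X \to \mathbf V_\bullet Y$ is proper.
   Context: $\mathcal O X$ is the lattice of open subsets of $X$. The specialization preordering of a space is: $x \leq y$ iff every open neighborhood of $x$ contains $y$; $\downarrow A$ denotes downward closure. A subset is saturated iff it is upwards-closed. Compactness is the open cover property, with no separation axiom. A continuous map $f \colon X \to Y$ is proper iff $\downarrow f[F]$ is closed for every closed $F \subseteq X$ and $f^{-1}(Q)$ is compact saturated for every compact saturated $Q \subseteq Y$. A continuous valuation on $X$ is a Scott-continuous map (monotonic and preserving directed suprema) $\nu \colon \mathcal O X \to \overline{\mathbb R}_+ = \mathbb R_+ \cup \{\infty\}$ with $\nu(\emptyset)=0$ and $\nu(U)+\nu(V)=\nu(U\cup V)+\nu(U\cap V)$ for all open $U,V$. $\mathbf V X$ is the space of all continuous valuations on $X$ with the weak topology, generated by the sets $\{\nu \mid \nu(U)>r\}$, $U \in \mathcal O X$, $r \in \mathbb R_+$. $\mathbf V_{\leq 1} X$ and $\mathbf V_1 X$ are the subspaces of those $\nu$ with $\nu(X)\leq 1$, resp. $\nu(X)=1$; $\mathbf V_\bullet$ is $\mathbf V$, $\mathbf V_{\leq 1}$ or $\mathbf V_1$ according to $\bullet$. For a continuous map $f \colon X \to Y$, $\mathbf V f$ maps $\nu$ to the valuation $V \mapsto \nu(f^{-1}(V))$. *)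

theory Defs
  imports "HOL-Analysis.Analysis"
begin

definition spec_le :: "'a topology \<Rightarrow> 'a \<Rightarrow> 'a \<Rightarrow> bool" where
  "spec_le X x y \<longleftrightarrow>
     x \<in> topspace X \<and> y \<in> topspace X \<and> (\<forall>U. openin X U \<longrightarrow> x \<in> U \<longrightarrow> y \<in> U)"

definition down_closure :: "'a topology \<Rightarrow> 'a set \<Rightarrow> 'a set" where
  "down_closure X A = {x. \<exists>a\<in>A. spec_le X x a}"

definition saturatedin :: "'a topology \<Rightarrow> 'a set \<Rightarrow> bool" where
  "saturatedin X A \<longleftrightarrow> A \<subseteq> topspace X \<and> (\<forall>x\<in>A. \<forall>y. spec_le X x y \<longrightarrow> y \<in> A)"

text \<open>This differs from the library's \<open>proper_map\<close> (closed with compact fibres):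
  only the downward closure of the image of a closed set is required to be closed.\<close>

definition proper_cont_map :: "'a topology \<Rightarrow> 'b topology \<Rightarrow> ('a \<Rightarrow> 'b) \<Rightarrow> bool" where
  "proper_cont_map X Y f \<longleftrightarrow>
     continuous_map X Y f \<and>
     (\<forall>F. closedin X F \<longrightarrow> closedin Y (down_closure Y (f ` F))) \<and>
     (\<forall>Q. compactin Y Q \<and> saturatedin Y Q \<longrightarrow>
        compactin X {x \<in> topspace X. f x \<in> Q} \<and> saturatedin X {x \<in> topspace X. f x \<in> Q})"

definition directed_family :: "'a set set \<Rightarrow> bool" where
  "directed_family D \<longleftrightarrow> D \<noteq> {} \<and> (\<forall>U\<in>D. \<forall>V\<in>D. \<exists>W\<in>D. U \<subseteq> W \<and> V \<subseteq> W)"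

text \<open>A valuation only has values on open sets; it is represented by the HOL function that is
  \<open>undefined\<close> elsewhere, so that equality of valuations is equality on open sets.\<close>

definition continuous_valuation :: "'a topology \<Rightarrow> ('a set \<Rightarrow> ennreal) \<Rightarrow> bool" where
  "continuous_valuation X \<nu> \<longleftrightarrow>
     \<nu> \<in> extensional {U. openin X U} \<and>
     \<nu> {} = 0 \<and>
     (\<forall>U V. openin X U \<and> openin X V \<longrightarrow> \<nu> U + \<nu> V = \<nu> (U \<union> V) + \<nu> (U \<inter> V)) \<and>
     (\<forall>U V. openin X U \<and> openin X V \<and> U \<subseteq> V \<longrightarrow> \<nu> U \<le> \<nu> V) \<and>
     (\<forall>D. (\<forall>U\<in>D. openin X U) \<and> directed_family D \<longrightarrow> \<nu> (\<Union>D) = (SUP U\<in>D. \<nu> U))"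

text \<open>The whole set of valuations is added to the subbase because
  \<^const>\<open>topology_generated_by\<close> takes the union of the subbase as the underlying set,
  and the zero valuation lies in none of the subbasic sets.\<close>

definition valuation_space :: "'a topology \<Rightarrow> ('a set \<Rightarrow> ennreal) topology" where
  "valuation_space X =
     topology_generated_by
       (insert {\<nu>. continuous_valuation X \<nu>}
          {{\<nu>. continuous_valuation X \<nu> \<and> \<nu> U > ennreal r} | U r. openin X U \<and> 0 \<le> r})"

definition subprob_valuation_space :: "'a topology \<Rightarrow> ('a set \<Rightarrow> ennreal) topology" where
  "subprob_valuation_space X = subtopology (valuation_space X) {\<nu>. \<nu> (topspace X) \<le> 1}"

definition prob_valuation_space :: "'a topology \<Rightarrow> ('a set \<Rightarrow> ennreal) topology" where
  "prob_valuation_space X = subtopology (valuation_space X) {\<nu>. \<nu> (topspace X) = 1}"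

definition valuation_map ::
  "'a topology \<Rightarrow> 'b topology \<Rightarrow> ('a \<Rightarrow> 'b) \<Rightarrow> ('a set \<Rightarrow> ennreal) \<Rightarrow> ('b set \<Rightarrow> ennreal)" where
  "valuation_map X Y f \<nu> = (\<lambda>V\<in>{V. openin Y V}. \<nu> {x \<in> topspace X. f x \<in> V})"

lemma topspace_valuation_space: "topspace (valuation_space X) = {\<nu>. continuous_valuation X \<nu>}"
  unfolding valuation_space_def topology_generated_by_topspace by auto

end

theory Submission imports Defs begin

text \<open>
  Write \<open>r\<^sub>* U\<close> for the set of points \<open>y\<close> of \<open>Y\<close> such that every \<open>x\<close> with \<open>y \<le> r x\<close> lies in \<open>U\<close>
  (\<open>lower_image\<close> below). Properness of \<open>r\<close> makes \<open>r\<^sub>*\<close> a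
  Scott-continuous map from the opens of \<open>X\<close> to the opens of \<open>Y\<close>, right adjoint to \<open>r\<close>-preimage and hence
  preserving binary intersections. By the adjunction, a valuation \<open>\<mu>\<close> on \<open>X\<close> has an image above
  \<open>\<nu>\<close> iff \<open>\<mu>\<close> lies above \<open>g = \<nu> \<circ> r\<^sub>*\<close>. This \<open>g\<close> is Scott-continuous, but only supermodular.

  Closedness of \<open>\<down>f[C]\<close> and compactness of the preimages of compact saturated sets both reduce to one fact about
  ultrafilters (\<open>valuation_map_ultralimit\<close>): if \<open>\<nu>\<^sub>i \<le> f(\<mu>\<^sub>i)\<close> and \<open>\<nu>\<^sub>i\<close> converges to \<open>\<nu>\<close> along an
  ultrafilter, then \<open>\<mu>\<^sub>i\<close> converges along it to some \<open>\<mu>\<close> with \<open>\<nu> \<le> f(\<mu>)\<close>, where \<open>f\<close> is the map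
  induced by \<open>r\<close>. The pointwise limit \<open>h\<close> of the \<open>\<mu>\<^sub>i\<close> exists since \<open>[0, \<infinity>]\<close> is compact; it is modular and
  lies above \<open>g\<close>, but it need not be Scott-continuous. In the weak topology, convergence to \<open>\<mu>\<close> means
  that the values at opens are eventually above every number below the value of \<open>\<mu>\<close>, so every continuous
  valuation \<open>\<mu> \<le> h\<close> is a limit. Hence it suffices to find a continuous valuation between \<open>g\<close> and \<open>h\<close>.

  That is \<open>capacity_sandwich\<close>. It is deduced from a sandwich theorem for functionals
  (\<open>functional_sandwich\<close>): between a Scott-continuous superadditive functional and a subadditive
  one above it there is a Scott-continuous additive one. Capacities become functionals by Choquet
  integration of bounded lower semicontinuous functions with values in the natural numbers, under which
  supermodularity turns into superadditivity and submodularity into subadditivity.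
\<close>

section \<open>Choquet integration of natural-valued lower semicontinuous functions\<close>

text \<open>
  Natural numbers suffice as values because only sums of indicator functions are needed, and they make
  the Choquet integral a finite sum over level sets.
\<close>

definition lsc_funs :: "'a topology \<Rightarrow> ('a \<Rightarrow> nat) set" where
  "lsc_funs X = {f. (\<forall>k. openin X {x. k < f x}) \<and> (\<exists>b. \<forall>x. f x \<le> b)}"

definition choquet :: "('a set \<Rightarrow> ennreal) \<Rightarrow> ('a \<Rightarrow> nat) \<Rightarrow> ennreal" where
  "choquet g f = (\<Sum>k. g {x. k < f x})"

abbreviation ind :: "'a set \<Rightarrow> 'a \<Rightarrow> nat" where
  "ind U \<equiv> (\<lambda>x. of_bool (x \<in> U))"

definition capacity_on :: "'a topology \<Rightarrow> ('a set \<Rightarrow> ennreal) \<Rightarrow> bool" where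
  "capacity_on X g \<longleftrightarrow> g {} = 0 \<and> (\<forall>U V. openin X U \<and> openin X V \<and> U \<subseteq> V \<longrightarrow> g U \<le> g V)"

definition supermodular_on :: "'a topology \<Rightarrow> ('a set \<Rightarrow> ennreal) \<Rightarrow> bool" where
  "supermodular_on X g \<longleftrightarrow>
     (\<forall>U V. openin X U \<and> openin X V \<longrightarrow> g U + g V \<le> g (U \<union> V) + g (U \<inter> V))"

definition submodular_on :: "'a topology \<Rightarrow> ('a set \<Rightarrow> ennreal) \<Rightarrow> bool" where
  "submodular_on X g \<longleftrightarrow>
     (\<forall>U V. openin X U \<and> openin X V \<longrightarrow> g (U \<union> V) + g (U \<inter> V) \<le> g U + g V)"

lemma choquet_eq_sum:
  assumes "g {} = 0" "\<And>x. f x \<le> b"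
  shows "choquet g f = (\<Sum>k<b. g {x. k < f x})"
  unfolding choquet_def
proof (rule suminf_finite)
  fix k assume "k \<notin> {..<b}"
  then have "{x. k < f x} = {}"
    using assms(2) by (auto simp: not_less intro: order_trans)
  then show "g {x. k < f x} = 0"
    by (simp add: assms(1))
qed simp

lemma choquet_ind: "g {} = 0 \<Longrightarrow> choquet g (ind U) = g U"
  by (subst choquet_eq_sum[where b = 1]) auto

lemma choquet_zero: "g {} = 0 \<Longrightarrow> choquet g (\<lambda>x. 0) = 0"
  by (subst choquet_eq_sum[where b = 0]) auto

lemma lsc_funs_zero: "(\<lambda>x. 0) \<in> lsc_funs X"
  by (auto simp: lsc_funs_def)

lemma lsc_funs_ind: "openin X U \<Longrightarrow> ind U \<in> lsc_funs X"
proof -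
  assume U: "openin X U"
  have "{x. k < ind U x} = (if k = 0 then U else {})" for k
    by (auto simp: of_bool_def)
  then show ?thesis
    using U by (auto simp: lsc_funs_def intro!: exI[of _ 1])
qed

lemma lsc_funs_add:
  assumes "f \<in> lsc_funs X" "h \<in> lsc_funs X"
  shows "(\<lambda>x. f x + h x) \<in> lsc_funs X"
proof -
  obtain b c where b: "\<And>x. f x \<le> b" and c: "\<And>x. h x \<le> c"
    using assms by (auto simp: lsc_funs_def)
  have "openin X {x. k < f x + h x}" for k
  proof -
    have "{x. k < f x + h x} =
      {x. k < f x} \<union> {x. k < h x} \<union> (\<Union>i<k. {x. i < f x} \<inter> {x. k - Suc i < h x})" (is "?L = ?R")
    proof (intro equalityI subsetI)
      fix x assume x: "x \<in> ?L"
      show "x \<in> ?R"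
      proof (cases "k < f x \<or> k < h x \<or> f x = 0")
        case False
        then show ?thesis using x by (auto intro!: bexI[of _ "f x - 1"])
      qed (use x in auto)
    qed auto
    then show ?thesis
      using assms by (auto simp: lsc_funs_def intro!: openin_Un openin_Union openin_Int)
  qed
  moreover have "f x + h x \<le> b + c" for x
    using b c by (simp add: add_mono)
  ultimately show ?thesis by (auto simp: lsc_funs_def)
qed

lemma lsc_funs_min:
  assumes "f \<in> lsc_funs X"
  shows "(\<lambda>x. min (f x) n) \<in> lsc_funs X"
proof -
  have "{x. k < min (f x) n} = (if k < n then {x. k < f x} else {})" for k by auto
  then show ?thesis using assms by (auto simp: lsc_funs_def intro!: exI[of _ n])
qed

text \<open>
  Adding an indicator moves level sets by one step: the level set at \<open>k\<close> of the sum is the union of the old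
  one with \<open>B k\<close>, where \<open>B (Suc k)\<close> is the part in \<open>U\<close> of the old level set at \<open>k\<close>. That the intersection
  is again \<open>B (Suc k)\<close> makes the (sub/super)modularity inequalities at successive levels telescope.
\<close>

lemma level_sets_add_ind:
  assumes "f \<in> lsc_funs X" "openin X U" "\<And>x. f x \<le> b"
  obtains B where "\<And>k. openin X (B k)" "B 0 = U" "\<And>k. B k \<subseteq> U" "B (Suc b) = {}"
    "\<And>k. {x. k < f x + ind U x} = {x. k < f x} \<union> B k"
    "\<And>k. {x. k < f x} \<inter> B k = B (Suc k)"
proof
  let ?B = "\<lambda>k. case k of 0 \<Rightarrow> U | Suc j \<Rightarrow> {x. j < f x} \<inter> U"
  show "openin X (?B k)" for k
    using assms by (auto simp: lsc_funs_def split: nat.split)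
  show "?B (Suc b) = {}"
    using assms(3) by (auto simp: leD)
  show "{x. k < f x + ind U x} = {x. k < f x} \<union> ?B k" for k
    by (auto simp: of_bool_def split: nat.split if_splits)
  show "{x. k < f x} \<inter> ?B k = ?B (Suc k)" for k
    by (auto split: nat.split)
qed (auto split: nat.split)

text \<open>
  Adding up the modularity inequalities over all levels, the two sums of \<open>g (B k)\<close> and of \<open>g (B (Suc k))\<close>
  differ only by \<open>g U\<close>. Their common part can be cancelled when \<open>g U\<close> is finite, and otherwise both
  inequalities hold because the larger side is infinite.
\<close>

lemma choquet_add_ind:
  assumes f: "f \<in> lsc_funs X" and U: "openin X U" and g: "capacity_on X g"
  shows "supermodular_on X g \<Longrightarrow> choquet g f + g U \<le> choquet g (\<lambda>x. f x + ind U x)"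
    and "submodular_on X g \<Longrightarrow> choquet g (\<lambda>x. f x + ind U x) \<le> choquet g f + g U"
proof -
  have g0: "g {} = 0" and mono: "\<And>U V. openin X U \<Longrightarrow> openin X V \<Longrightarrow> U \<subseteq> V \<Longrightarrow> g U \<le> g V"
    using g by (auto simp: capacity_on_def)
  obtain b where b: "\<And>x. f x \<le> b" using f by (auto simp: lsc_funs_def)
  obtain B where B: "\<And>k. openin X (B k)" "B 0 = U" "\<And>k. B k \<subseteq> U" "B (Suc b) = {}"
    and un: "\<And>k. {x. k < f x + ind U x} = {x. k < f x} \<union> B k"
    and int: "\<And>k. {x. k < f x} \<inter> B k = B (Suc k)"
    using level_sets_add_ind[OF f U b] by blast
  have A: "openin X {x. k < f x}" for k using f by (auto simp: lsc_funs_def)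
  have f_eq: "choquet g f = (\<Sum>k<Suc b. g {x. k < f x})"
    using b by (intro choquet_eq_sum g0 le_SucI)
  have fU_eq: "choquet g (\<lambda>x. f x + ind U x) = (\<Sum>k<Suc b. g ({x. k < f x} \<union> B k))"
    unfolding un[symmetric] using b by (intro choquet_eq_sum g0) (auto simp: of_bool_def intro: le_SucI)
  \<comment> \<open>The part common to both sides, which is to be cancelled.\<close>
  define T where "T = (\<Sum>k<Suc b. g (B (Suc k)))"
  have shift: "(\<Sum>k<Suc b. g (B k)) = g U + T"
  proof -
    have "T = (\<Sum>k<b. g (B (Suc k)))" by (simp add: T_def B(4) g0)
    then show ?thesis by (subst sum.lessThan_Suc_shift) (simp add: B(2))
  qed
  have T_fin: "T \<noteq> \<infinity>" if "g U \<noteq> \<infinity>"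
  proof -
    have "g (B k) \<noteq> \<infinity>" for k
      using mono[OF B(1) U B(3), of k] that by (auto simp: top_unique)
    then show ?thesis by (simp add: T_def)
  qed
  {
    assume sup: "supermodular_on X g"
    show "choquet g f + g U \<le> choquet g (\<lambda>x. f x + ind U x)"
    proof (cases "g U = \<infinity>")
      case True
      have "g U \<le> g ({x. 0 < f x} \<union> B 0)" using A B by (intro mono) auto
      also have "\<dots> \<le> choquet g (\<lambda>x. f x + ind U x)"
        unfolding fU_eq by (rule member_le_sum) auto
      finally show ?thesis using True by (simp add: top_unique)
    next
      case False
      have "(choquet g f + g U) + T = (\<Sum>k<Suc b. g {x. k < f x} + g (B k))"
        unfolding sum.distrib shift f_eq by (simp add: add.assoc)
      also have "\<dots> \<le> (\<Sum>k<Suc b. g ({x. k < f x} \<union> B k) + g (B (Suc k)))"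
        using sup A B(1) unfolding supermodular_on_def by (intro sum_mono) (metis int)
      also have "\<dots> = choquet g (\<lambda>x. f x + ind U x) + T"
        unfolding sum.distrib fU_eq T_def ..
      finally show ?thesis using T_fin[OF False]
        by (simp add: add.commute[of _ T] ennreal_add_left_cancel_le)
    qed
  next
    assume sub: "submodular_on X g"
    show "choquet g (\<lambda>x. f x + ind U x) \<le> choquet g f + g U"
    proof (cases "g U = \<infinity>")
      case False
      have "choquet g (\<lambda>x. f x + ind U x) + T = (\<Sum>k<Suc b. g ({x. k < f x} \<union> B k) + g (B (Suc k)))"
        unfolding sum.distrib fU_eq T_def ..
      also have "\<dots> \<le> (\<Sum>k<Suc b. g {x. k < f x} + g (B k))"
        using sub A B(1) unfolding submodular_on_def by (intro sum_mono) (metis int)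
      also have "\<dots> = (choquet g f + g U) + T"
        unfolding sum.distrib shift f_eq by (simp add: add.assoc)
      finally show ?thesis using T_fin[OF False]
        by (simp add: add.commute[of _ T] ennreal_add_left_cancel_le)
    qed simp
  }
qed

lemma min_Suc_eq_add_ind: "min (h x) (Suc n) = min (h x) n + ind {x. n < h x} x"
  by (auto simp: of_bool_def)

text \<open>
  A bounded function is the sum of the indicators of its level sets, so additivity properties follow by
  adding these indicators one at a time.
\<close>

lemma choquet_superadditive:
  assumes f: "f \<in> lsc_funs X" and h: "h \<in> lsc_funs X" and g: "capacity_on X g" "supermodular_on X g"
  shows "choquet g f + choquet g h \<le> choquet g (\<lambda>x. f x + h x)"
proof -
  obtain b where b: "\<And>x. h x \<le> b" using h by (auto simp: lsc_funs_def)
  have g0: "g {} = 0" using g by (auto simp: capacity_on_def)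
  have "choquet g f + (\<Sum>k<n. g {x. k < h x}) \<le> choquet g (\<lambda>x. f x + min (h x) n)" for n
  proof (induction n)
    case (Suc n)
    let ?U = "{x. n < h x}"
    have "choquet g f + (\<Sum>k<Suc n. g {x. k < h x}) \<le> choquet g (\<lambda>x. f x + min (h x) n) + g ?U"
      using Suc.IH by (simp add: add.assoc[symmetric] add_right_mono)
    also have "\<dots> \<le> choquet g (\<lambda>x. (f x + min (h x) n) + ind ?U x)"
      using h by (intro choquet_add_ind[OF _ _ g(1)] lsc_funs_add[OF f] lsc_funs_min g) (auto simp: lsc_funs_def)
    finally show ?case by (simp only: min_Suc_eq_add_ind add.assoc)
  qed simp
  from this[of b] show ?thesis
    using b by (simp add: choquet_eq_sum[of g h b] g0 min_absorb1)
qed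

lemma choquet_subadditive:
  assumes f: "f \<in> lsc_funs X" and h: "h \<in> lsc_funs X" and g: "capacity_on X g" "submodular_on X g"
  shows "choquet g (\<lambda>x. f x + h x) \<le> choquet g f + choquet g h"
proof -
  obtain b where b: "\<And>x. h x \<le> b" using h by (auto simp: lsc_funs_def)
  have g0: "g {} = 0" using g by (auto simp: capacity_on_def)
  have "choquet g (\<lambda>x. f x + min (h x) n) \<le> choquet g f + (\<Sum>k<n. g {x. k < h x})" for n
  proof (induction n)
    case (Suc n)
    let ?U = "{x. n < h x}"
    have "choquet g (\<lambda>x. f x + min (h x) (Suc n)) = choquet g (\<lambda>x. (f x + min (h x) n) + ind ?U x)"
      by (simp only: min_Suc_eq_add_ind add.assoc)
    also have "\<dots> \<le> choquet g (\<lambda>x. f x + min (h x) n) + g ?U"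
      using h by (intro choquet_add_ind[OF _ _ g(1)] lsc_funs_add[OF f] lsc_funs_min g) (auto simp: lsc_funs_def)
    also have "\<dots> \<le> choquet g f + (\<Sum>k<Suc n. g {x. k < h x})"
      using Suc.IH by (simp add: add.assoc[symmetric] add_right_mono)
    finally show ?case .
  qed simp
  from this[of b] show ?thesis
    using b by (simp add: choquet_eq_sum[of g h b] g0 min_absorb1)
qed

text \<open>
  A natural-valued directed supremum is attained at each point, so the condition that \<open>f\<close> is below the
  supremum of \<open>D\<close> can be stated pointwise. As \<open>f\<close> is only required to be below, this includes monotonicity.
\<close>

definition scott_continuous_on :: "('a \<Rightarrow> nat) set \<Rightarrow> (('a \<Rightarrow> nat) \<Rightarrow> ennreal) \<Rightarrow> bool" where
  "scott_continuous_on L q \<longleftrightarrow>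
     (\<forall>f\<in>L. \<forall>D\<subseteq>L. D \<noteq> {} \<and> (\<forall>d\<in>D. \<forall>e\<in>D. \<exists>c\<in>D. d \<le> c \<and> e \<le> c) \<and> (\<forall>x. \<exists>d\<in>D. f x \<le> d x)
        \<longrightarrow> q f \<le> (SUP d\<in>D. q d))"

lemma choquet_scott_continuous:
  assumes g: "capacity_on X g"
    and sc: "\<And>D. (\<And>U. U \<in> D \<Longrightarrow> openin X U) \<Longrightarrow> directed_family D \<Longrightarrow> g (\<Union>D) \<le> (SUP U\<in>D. g U)"
  shows "scott_continuous_on (lsc_funs X) (choquet g)"
  unfolding scott_continuous_on_def
proof (intro ballI allI impI, elim conjE)
  fix f D assume f: "f \<in> lsc_funs X" and D: "D \<subseteq> lsc_funs X" "D \<noteq> {}"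
    "\<forall>d\<in>D. \<forall>e\<in>D. \<exists>c\<in>D. d \<le> c \<and> e \<le> c" "\<forall>x. \<exists>d\<in>D. f x \<le> d x"
  have mono: "\<And>U V. openin X U \<Longrightarrow> openin X V \<Longrightarrow> U \<subseteq> V \<Longrightarrow> g U \<le> g V"
    using g by (auto simp: capacity_on_def)
  have op: "openin X {x. k < d x}" if "d \<in> D" for k d
    using that D(1) by (auto simp: lsc_funs_def)
  have level: "g {x. k < f x} \<le> (SUP d\<in>D. g {x. k < d x})" for k
  proof -
    let ?E = "(\<lambda>d. {x. k < d x}) ` D"
    have dir: "directed_family ?E"
      unfolding directed_family_def
    proof (intro conjI ballI)
      fix U V assume "U \<in> ?E" "V \<in> ?E"
      then obtain d e where de: "d \<in> D" "e \<in> D" "U = {x. k < d x}" "V = {x. k < e x}" by auto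
      then obtain c where "c \<in> D" "d \<le> c" "e \<le> c" using D(3) by blast
      then show "\<exists>W\<in>?E. U \<subseteq> W \<and> V \<subseteq> W"
        using de by (intro bexI[of _ "{x. k < c x}"]) (auto simp: le_fun_def intro: less_le_trans)
    qed (use D(2) in auto)
    have "g {x. k < f x} \<le> g (\<Union>?E)"
    proof (rule mono)
      show "openin X {x. k < f x}" using f by (auto simp: lsc_funs_def)
      show "openin X (\<Union>?E)" using op by auto
      show "{x. k < f x} \<subseteq> \<Union>?E" using D(4) by (auto intro: less_le_trans)
    qed
    also have "\<dots> \<le> (SUP U\<in>?E. g U)" using op by (intro sc dir) auto
    finally show ?thesis by (simp add: image_image)
  qed
  have "choquet g f \<le> (\<Sum>k. SUP d\<in>D. g {x. k < d x})"
    unfolding choquet_def by (intro suminf_le level) auto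
  also have "\<dots> = (SUP d\<in>D. \<Sum>k. g {x. k < d x})"
  proof (rule ennreal_suminf_SUP_eq_directed)
    fix N :: "nat set" and i j assume "i \<in> D" "j \<in> D"
    then obtain c where c: "c \<in> D" "i \<le> c" "j \<le> c" using D(3) by blast
    with \<open>i \<in> D\<close> \<open>j \<in> D\<close> show "\<exists>k\<in>D. \<forall>n\<in>N. g {x. n < i x} \<le> g {x. n < k x} \<and> g {x. n < j x} \<le> g {x. n < k x}"
      by (intro bexI[of _ c] ballI conjI mono op) (auto simp: le_fun_def intro: less_le_trans)
  qed
  finally show "choquet g f \<le> (SUP d\<in>D. choquet g d)" by (simp add: choquet_def)
qed

section \<open>A sandwich theorem for functionals\<close>

locale additive_cone =
  fixes L :: "('a \<Rightarrow> nat) set"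
  assumes zero_mem: "(\<lambda>x. 0) \<in> L"
    and add_mem: "\<And>f g. f \<in> L \<Longrightarrow> g \<in> L \<Longrightarrow> (\<lambda>x. f x + g x) \<in> L"
begin

lemma scale_mem: "f \<in> L \<Longrightarrow> (\<lambda>x. n * f x) \<in> L"
proof (induction n)
  case (Suc n)
  then show ?case using add_mem[of f "\<lambda>x. n * f x"] by simp
qed (simp add: zero_mem)

definition superadditive where
  "superadditive q \<longleftrightarrow> (\<forall>f\<in>L. \<forall>g\<in>L. q f + q g \<le> (q (\<lambda>x. f x + g x) :: ennreal))"

definition subadditive where
  "subadditive p \<longleftrightarrow>
     p (\<lambda>x. 0) = 0 \<and> (\<forall>f\<in>L. \<forall>g\<in>L. p (\<lambda>x. f x + g x) \<le> (p f + p g :: ennreal))"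

lemma superadditive_scale:
  assumes "superadditive q" "f \<in> L"
  shows "of_nat n * q f \<le> q (\<lambda>x. n * f x)"
proof (induction n)
  case (Suc n)
  have "of_nat (Suc n) * q f \<le> q f + q (\<lambda>x. n * f x)"
    using Suc.IH by (simp add: distrib_right add_left_mono)
  also have "\<dots> \<le> q (\<lambda>x. f x + n * f x)"
    using assms scale_mem by (auto simp: superadditive_def)
  finally show ?case by simp
qed simp

lemma subadditive_scale:
  assumes "subadditive p" "f \<in> L"
  shows "p (\<lambda>x. n * f x) \<le> of_nat n * p f"
proof (induction n)
  case (Suc n)
  have "p (\<lambda>x. f x + n * f x) \<le> p f + p (\<lambda>x. n * f x)"
    using assms scale_mem by (auto simp: subadditive_def)
  also have "\<dots> \<le> of_nat (Suc n) * p f"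
    using Suc.IH by (simp add: distrib_right add_left_mono)
  finally show ?case by simp
qed (use assms in \<open>simp add: subadditive_def\<close>)

lemma scott_continuousD:
  assumes "scott_continuous_on L q" "f \<in> L" "D \<subseteq> L" "D \<noteq> {}"
    "\<And>d e. d \<in> D \<Longrightarrow> e \<in> D \<Longrightarrow> \<exists>c\<in>D. d \<le> c \<and> e \<le> c" "\<And>x. \<exists>d\<in>D. f x \<le> d x"
  shows "q f \<le> (SUP d\<in>D. q d)"
  using assms unfolding scott_continuous_on_def by blast

definition minorants where
  "minorants p = {q. superadditive q \<and> scott_continuous_on L q \<and> (\<forall>f\<in>L. q f \<le> p f)}"

text \<open>
  Zorn's lemma applies because pointwise suprema of chains preserve superadditivity and Scott-continuity.
\<close>

lemma ex_maximal_minorant: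
  assumes q0: "q0 \<in> minorants p"
  obtains q where "q \<in> minorants p" "q0 \<le> q" "\<And>q'. q' \<in> minorants p \<Longrightarrow> q \<le> q' \<Longrightarrow> q' = q"
proof -
  let ?A = "{q \<in> minorants p. q0 \<le> q}"
  have "\<exists>m\<in>?A. \<forall>a\<in>?A. m \<le> a \<longrightarrow> a = m"
  proof (rule predicate_Zorn)
    show "partial_order_on ?A (relation_of (\<le>) ?A)"
      by (rule partial_order_on_relation_ofI) auto
    fix C assume C: "C \<in> Chains (relation_of (\<le>) ?A)"
    then have CA: "C \<subseteq> ?A" and chain: "\<And>a b. a \<in> C \<Longrightarrow> b \<in> C \<Longrightarrow> a \<le> b \<or> b \<le> a"
      by (auto simp: Chains_def relation_of_def)
    show "\<exists>u\<in>?A. \<forall>a\<in>C. a \<le> u"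
    proof (cases "C = {}")
      case False
      let ?u = "\<lambda>f. SUP q\<in>C. q f"
      have up: "a f \<le> ?u f" if "a \<in> C" for a f using that by (rule SUP_upper)
      have "superadditive ?u"
        unfolding superadditive_def
      proof (intro ballI)
        fix f g assume fg: "f \<in> L" "g \<in> L"
        have "?u f + ?u g = (SUP q\<in>C. q f + q g)"
        proof (rule SUP_add_directed_ennreal[symmetric])
          fix a b assume "a \<in> C" "b \<in> C"
          with chain[OF this] show "\<exists>k\<in>C. a f + b g \<le> k f + k g"
            by (auto simp: le_fun_def intro: add_mono)
        qed
        also have "\<dots> \<le> ?u (\<lambda>x. f x + g x)"
        proof (rule SUP_mono)
          fix a assume a: "a \<in> C"
          then show "\<exists>m\<in>C. a f + a g \<le> m (\<lambda>x. f x + g x)"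
            using CA fg by (auto simp: minorants_def superadditive_def intro!: bexI[of _ a])
        qed
        finally show "?u f + ?u g \<le> ?u (\<lambda>x. f x + g x)" .
      qed
      moreover have "scott_continuous_on L ?u"
        unfolding scott_continuous_on_def
      proof (intro ballI allI impI SUP_least)
        fix f D a assume *: "f \<in> L" "D \<subseteq> L" "a \<in> C"
          "D \<noteq> {} \<and> (\<forall>d\<in>D. \<forall>e\<in>D. \<exists>c\<in>D. d \<le> c \<and> e \<le> c) \<and> (\<forall>x. \<exists>d\<in>D. f x \<le> d x)"
        then have "a f \<le> (SUP d\<in>D. a d)"
          using CA by (intro scott_continuousD) (auto simp: minorants_def)
        also have "\<dots> \<le> (SUP d\<in>D. ?u d)"
          by (intro SUP_mono' up *)
        finally show "a f \<le> (SUP d\<in>D. ?u d)" .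
      qed
      moreover have "\<forall>f\<in>L. ?u f \<le> p f"
        using CA by (auto simp: minorants_def intro!: SUP_least)
      moreover have "q0 \<le> ?u"
      proof -
        obtain a where a: "a \<in> C" using False by auto
        then have "q0 \<le> a" using CA by auto
        also have "a \<le> ?u" using up[OF a] by (rule le_funI)
        finally show ?thesis .
      qed
      ultimately show ?thesis
        using up by (intro bexI[of _ ?u]) (auto simp: minorants_def le_fun_def)
    qed (use q0 in auto)
  qed
  then obtain q where q: "q \<in> minorants p" "q0 \<le> q" "\<And>q'. q' \<in> ?A \<Longrightarrow> q \<le> q' \<Longrightarrow> q' = q"
    by blast
  show ?thesis
    by (rule that[OF q(1,2)]) (use q(2,3) in \<open>auto intro: order_trans\<close>)
qed

text \<open>
  The use of maximality. If the value \<open>t\<close> at \<open>h\<close> is compatible with the bound \<open>p\<close>, then one may try to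
  enlarge \<open>q\<close> at \<open>z\<close> to the supremum of \<open>(q (m z + n h) - n t) / m\<close>, the values that additivity would
  force if \<open>h\<close> had the value \<open>t\<close>. The result is again a minorant of \<open>p\<close>; in particular it is
  Scott-continuous, because \<open>z\<close> is sent to \<open>m z + n h\<close> by a Scott-continuous map. So by maximality it
  equals \<open>q\<close>.
\<close>

lemma maximal_minorant_increment:
  assumes p: "subadditive p" and q: "q \<in> minorants p"
    and max: "\<And>q'. q' \<in> minorants p \<Longrightarrow> q \<le> q' \<Longrightarrow> q' = q"
    and h: "h \<in> L" and t: "t \<noteq> \<infinity>"
    and bound: "\<And>z n. z \<in> L \<Longrightarrow> q (\<lambda>x. z x + n * h x) \<le> p z + of_nat n * t"
    and z: "z \<in> L" and m: "0 < m"
  shows "q (\<lambda>x. m * z x + n * h x) \<le> of_nat m * q z + of_nat n * t"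
proof -
  \<comment> \<open>The inequality is kept free of subtraction and division, so that infinite values need no care.\<close>
  define S where "S z = {s. \<exists>m n. 0 < m \<and> of_nat m * s + of_nat n * t \<le> q (\<lambda>x. m * z x + n * h x)}" for z
  define q' where "q' z = (if z \<in> L then Sup (S z) else q z)" for z
  have qsup: "superadditive q" and qsc: "scott_continuous_on L q" and qp: "\<And>f. f \<in> L \<Longrightarrow> q f \<le> p f"
    using q by (auto simp: minorants_def)
  have nt: "of_nat n * t \<noteq> \<infinity>" for n :: nat
    using t by (auto simp: ennreal_mult_eq_top_iff)
  have comb: "(\<lambda>x. m * z x + n * h x) \<in> L" if "z \<in> L" for z m n
    using that h by (intro add_mem scale_mem)
  have q_in: "q z \<in> S z" for z
    unfolding S_def by (intro CollectI exI[of _ 1] exI[of _ 0]) simp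
  have S_le: "s \<le> q' z" if "s \<in> S z" "z \<in> L" for s z
    using that by (auto simp: q'_def intro: Sup_upper)
  have "q \<le> q'"
    using q_in by (auto simp: le_fun_def q'_def intro: Sup_upper)
  moreover have "q' \<in> minorants p"
    unfolding minorants_def
  proof (intro CollectI conjI ballI)
    fix z assume z: "z \<in> L"
    have "s \<le> p z" if "s \<in> S z" for s
    proof -
      from that obtain m n where mn: "0 < m"
        and le: "of_nat m * s + of_nat n * t \<le> q (\<lambda>x. m * z x + n * h x)"
        by (auto simp: S_def)
      note le
      also have "q (\<lambda>x. m * z x + n * h x) \<le> p (\<lambda>x. m * z x) + of_nat n * t"
        by (rule bound[OF scale_mem[OF z]])
      also have "\<dots> \<le> of_nat m * p z + of_nat n * t"
        by (intro add_right_mono subadditive_scale p z)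
      finally have "of_nat m * s \<le> of_nat m * p z"
        using nt[of n] by simp
      then show ?thesis
        using mn by (subst (asm) ennreal_mult_le_mult_iff) auto
    qed
    then show "q' z \<le> p z" using z by (auto simp: q'_def intro: Sup_least)
  next
    show "superadditive q'"
      unfolding superadditive_def
    proof (intro ballI)
      fix f g assume fg: "f \<in> L" "g \<in> L"
      have *: "s + s' \<in> S (\<lambda>x. f x + g x)" if "s \<in> S f" "s' \<in> S g" for s s'
      proof -
        from that obtain m n m' n' where mn: "0 < m" "0 < m'"
          and le: "of_nat m * s + of_nat n * t \<le> q (\<lambda>x. m * f x + n * h x)"
            "of_nat m' * s' + of_nat n' * t \<le> q (\<lambda>x. m' * g x + n' * h x)"
          by (auto simp: S_def)
        let ?N = "m' * n + m * n'"
        have "of_nat (m * m') * (s + s') + of_nat ?N * t =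
          of_nat m' * (of_nat m * s + of_nat n * t) + of_nat m * (of_nat m' * s' + of_nat n' * t)"
          by (simp add: algebra_simps)
        also have "\<dots> \<le> of_nat m' * q (\<lambda>x. m * f x + n * h x) + of_nat m * q (\<lambda>x. m' * g x + n' * h x)"
          by (intro add_mono mult_left_mono le) auto
        also have "\<dots> \<le> q (\<lambda>x. m' * (m * f x + n * h x)) + q (\<lambda>x. m * (m' * g x + n' * h x))"
          by (intro add_mono superadditive_scale[OF qsup] comb fg)
        also have "\<dots> \<le> q (\<lambda>x. m' * (m * f x + n * h x) + m * (m' * g x + n' * h x))"
          using qsup comb[OF fg(1)] comb[OF fg(2)] scale_mem unfolding superadditive_def by blast
        also have "(\<lambda>x. m' * (m * f x + n * h x) + m * (m' * g x + n' * h x)) =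
            (\<lambda>x. (m * m') * (f x + g x) + ?N * h x)"
          by (simp add: algebra_simps)
        finally show ?thesis
          using mn unfolding S_def by (intro CollectI exI[of _ "m * m'"] exI[of _ ?N]) simp
      qed
      have ne: "S f \<noteq> {}" "S g \<noteq> {}" using q_in by auto
      have "Sup (S f) + Sup (S g) = (SUP s\<in>S f. s + Sup (S g))"
        using ennreal_SUP_add_left[OF ne(1), of "\<lambda>s. s"] by simp
      also have "\<dots> = (SUP s\<in>S f. SUP s'\<in>S g. s + s')"
        using ennreal_SUP_add_right[OF ne(2), of _ "\<lambda>s. s"] by simp
      also have "\<dots> \<le> q' (\<lambda>x. f x + g x)"
        by (intro SUP_least S_le * add_mem fg)
      finally show "q' f + q' g \<le> q' (\<lambda>x. f x + g x)"
        using fg by (simp add: q'_def)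
    qed
  next
    show "scott_continuous_on L q'"
      unfolding scott_continuous_on_def
    proof (intro ballI allI impI, elim conjE)
      fix f D assume f: "f \<in> L" and D: "D \<subseteq> L" "D \<noteq> {}"
        "\<forall>d\<in>D. \<forall>e\<in>D. \<exists>c\<in>D. d \<le> c \<and> e \<le> c" "\<forall>x. \<exists>d\<in>D. f x \<le> d x"
      have "s \<le> (SUP d\<in>D. q' d)" if "s \<in> S f" for s
      proof (rule dense_le)
        fix u assume u: "u < s"
        from that obtain m n where mn: "0 < m"
          and le: "of_nat m * s + of_nat n * t \<le> q (\<lambda>x. m * f x + n * h x)"
          by (auto simp: S_def)
        have "of_nat m * u < of_nat m * s"
          using u mn by (intro ennreal_mult_strict_left_mono) (auto simp: of_nat_less_top)
        then have "of_nat m * u + of_nat n * t < of_nat m * s + of_nat n * t"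
          using nt[of n] by (simp add: add.commute[of _ "of_nat n * t"] ennreal_add_left_cancel_less)
        also note le
        also have "q (\<lambda>x. m * f x + n * h x) \<le> (SUP e\<in>(\<lambda>d x. m * d x + n * h x) ` D. q e)"
        proof (rule scott_continuousD[OF qsc])
          fix d e assume "d \<in> (\<lambda>d x. m * d x + n * h x) ` D" "e \<in> (\<lambda>d x. m * d x + n * h x) ` D"
          then obtain d' e' where de: "d' \<in> D" "e' \<in> D"
            "d = (\<lambda>x. m * d' x + n * h x)" "e = (\<lambda>x. m * e' x + n * h x)" by auto
          then obtain c where "c \<in> D" "d' \<le> c" "e' \<le> c" using D(3) by blast
          then show "\<exists>c\<in>(\<lambda>d x. m * d x + n * h x) ` D. d \<le> c \<and> e \<le> c"
            using de by (intro bexI[of _ "\<lambda>x. m * c x + n * h x"]) (auto simp: le_fun_def)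
        next
          fix x
          obtain d where "d \<in> D" "f x \<le> d x" using D(4) by blast
          then show "\<exists>d\<in>(\<lambda>d x. m * d x + n * h x) ` D. m * f x + n * h x \<le> d x"
            by (intro bexI[of _ "\<lambda>x. m * d x + n * h x"]) auto
        qed (use D comb f in auto)
        finally obtain d where d: "d \<in> D" "of_nat m * u + of_nat n * t < q (\<lambda>x. m * d x + n * h x)"
          by (auto simp: less_SUP_iff image_image)
        then have "u \<in> S d" using mn by (auto simp: S_def intro: less_imp_le)
        then have "u \<le> q' d" using d D(1) by (auto intro: S_le)
        then show "u \<le> (SUP d\<in>D. q' d)" using d(1) by (rule SUP_upper2[rotated])
      qed
      then show "q' f \<le> (SUP d\<in>D. q' d)" using f by (auto simp: q'_def intro: Sup_least)
    qed
  qed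
  ultimately have qq: "q' = q" using max by blast
  let ?Q = "q (\<lambda>x. m * z x + n * h x)"
  show ?thesis
  proof (cases "of_nat n * t \<le> ?Q")
    case True
    let ?s = "(?Q - of_nat n * t) / of_nat m"
    have ms: "of_nat m * ?s + of_nat n * t = ?Q"
      using m True nt[of n]
      by (simp add: ennreal_times_divide mult.commute[of "of_nat m"] ennreal_mult_divide_eq diff_add_cancel_ennreal)
    then have "?s \<in> S z" using m unfolding S_def by (intro CollectI exI[of _ m] exI[of _ n]) simp
    then have "?s \<le> q z" using S_le z qq by auto
    then have "of_nat m * ?s + of_nat n * t \<le> of_nat m * q z + of_nat n * t"
      by (intro add_right_mono mult_left_mono) auto
    then show ?thesis by (simp only: ms)
  next
    case False
    then show ?thesis by (simp add: add_increasing)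
  qed
qed

text \<open>
  Let \<open>q\<close> be maximal and let \<open>c h\<close> be the least bound on the increments of \<open>q\<close> caused by adding \<open>h\<close>, so that
  \<open>q (z + h) \<le> q z + c h\<close>. Maximality gives \<open>c \<le> p\<close>, since \<open>p h\<close> is a compatible value at \<open>h\<close>. But
  then \<open>q (z + n h) \<le> q (n h) + c z \<le> n (q h) + p z\<close>, which says that \<open>q h\<close> is itself a compatible value, so
  maximality gives even \<open>c \<le> q\<close>. Hence \<open>q\<close> is subadditive as well as superadditive.
\<close>

theorem functional_sandwich:
  assumes p: "subadditive p" and q0: "superadditive q0" "scott_continuous_on L q0"
    and le: "\<And>f. f \<in> L \<Longrightarrow> q0 f \<le> p f"
  shows "\<exists>q. scott_continuous_on L q \<and> (\<forall>f\<in>L. q0 f \<le> q f \<and> q f \<le> p f) \<and>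
    (\<forall>f\<in>L. \<forall>g\<in>L. q (\<lambda>x. f x + g x) = q f + q g)"
proof -
  have "q0 \<in> minorants p" using q0 le by (auto simp: minorants_def)
  then obtain q where q: "q \<in> minorants p" "q0 \<le> q"
    and max: "\<And>q'. q' \<in> minorants p \<Longrightarrow> q \<le> q' \<Longrightarrow> q' = q"
    using ex_maximal_minorant by blast
  have qsup: "superadditive q" and qsc: "scott_continuous_on L q" and qp: "\<And>f. f \<in> L \<Longrightarrow> q f \<le> p f"
    using q by (auto simp: minorants_def)
  note incr = maximal_minorant_increment[OF p q(1) max]
  define c where "c h = Inf {t. \<forall>z\<in>L. q (\<lambda>x. z x + h x) \<le> q z + t}" for h
  have c_lower: "c h \<le> t" if "\<And>z. z \<in> L \<Longrightarrow> q (\<lambda>x. z x + h x) \<le> q z + t" for h t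
    unfolding c_def using that by (intro Inf_lower) auto
  have q_add_le: "q (\<lambda>x. z x + h x) \<le> q z + c h" if z: "z \<in> L" for z h
  proof (cases "q z = \<infinity>")
    case False
    show ?thesis
    proof (rule ccontr)
      assume "\<not> ?thesis"
      then have lt: "q z + c h < q (\<lambda>x. z x + h x)" by (simp add: not_le)
      then have "c h < q (\<lambda>x. z x + h x) - q z"
        using False by (simp add: less_diff_eq_ennreal add.commute less_top)
      then obtain t where t: "\<forall>z\<in>L. q (\<lambda>x. z x + h x) \<le> q z + t" "t < q (\<lambda>x. z x + h x) - q z"
        unfolding c_def Inf_less_iff by auto
      then have "q z + t < q (\<lambda>x. z x + h x)"
        using False by (simp add: less_diff_eq_ennreal add.commute less_top)
      with t(1) z show False by (auto simp: not_le[symmetric])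
    qed
  qed simp
  have c_le: "c h \<le> t"
    if h: "h \<in> L" and t: "t \<noteq> \<infinity>" and b: "\<And>z n. z \<in> L \<Longrightarrow> q (\<lambda>x. z x + n * h x) \<le> p z + of_nat n * t" for h t
  proof (rule c_lower)
    fix z assume "z \<in> L"
    from incr[OF _ _ h t b this, of 1 1] show "q (\<lambda>x. z x + h x) \<le> q z + t" by simp
  qed
  have cp: "c h \<le> p h" if h: "h \<in> L" for h
  proof (cases "p h = \<infinity>")
    case False
    show ?thesis
    proof (rule c_le[OF h False])
      fix z n assume z: "z \<in> L"
      have "q (\<lambda>x. z x + n * h x) \<le> p (\<lambda>x. z x + n * h x)" by (intro qp add_mem scale_mem h z)
      also have "\<dots> \<le> p z + p (\<lambda>x. n * h x)"
        using p z scale_mem[OF h] by (auto simp: subadditive_def)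
      also have "\<dots> \<le> p z + of_nat n * p h"
        by (intro add_left_mono subadditive_scale p h)
      finally show "q (\<lambda>x. z x + n * h x) \<le> p z + of_nat n * p h" .
    qed
  qed simp
  \<comment> \<open>Maximality forces homogeneity: take the zero function with value zero as the increment.\<close>
  have homog: "q (\<lambda>x. n * h x) \<le> of_nat n * q h" if h: "h \<in> L" for h n
  proof (cases "n = 0")
    case True
    then show ?thesis using qp[OF zero_mem] p by (simp add: subadditive_def)
  next
    case False
    have "q (\<lambda>x. n * h x + 0 * 0) \<le> of_nat n * q h + of_nat 0 * 0"
    proof (rule incr[OF _ _ zero_mem _ _ h])
      show "q (\<lambda>x. z x + n * 0) \<le> p z + of_nat n * 0" if "z \<in> L" for z n
        using qp[OF that] by simp
    qed (use False in auto)
    then show ?thesis by simp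
  qed
  have cq: "c h \<le> q h" if h: "h \<in> L" for h
  proof (cases "q h = \<infinity>")
    case False
    show ?thesis
    proof (rule c_le[OF h False])
      fix z n assume z: "z \<in> L"
      have "q (\<lambda>x. z x + n * h x) \<le> q (\<lambda>x. n * h x) + c z"
        using q_add_le[OF scale_mem[OF h], of n z] by (simp add: add.commute)
      also have "\<dots> \<le> of_nat n * q h + p z"
        by (intro add_mono homog h cp z)
      finally show "q (\<lambda>x. z x + n * h x) \<le> p z + of_nat n * q h"
        by (simp add: add.commute)
    qed
  qed simp
  have "q (\<lambda>x. f x + g x) = q f + q g" if fg: "f \<in> L" "g \<in> L" for f g
  proof (rule antisym)
    show "q (\<lambda>x. f x + g x) \<le> q f + q g"
      using q_add_le[OF fg(1), of g] cq[OF fg(2)] by (meson add_left_mono order_trans)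
    show "q f + q g \<le> q (\<lambda>x. f x + g x)"
      using qsup fg by (auto simp: superadditive_def)
  qed
  then show ?thesis
    using qsc qp q(2) by (intro exI[of _ q]) (auto simp: le_fun_def)
qed

end

section \<open>Continuous valuations between capacities\<close>

lemma continuous_valuationD:
  assumes "continuous_valuation X \<nu>"
  shows "\<nu> {} = 0"
    and "openin X U \<Longrightarrow> openin X V \<Longrightarrow> \<nu> U + \<nu> V = \<nu> (U \<union> V) + \<nu> (U \<inter> V)"
    and "openin X U \<Longrightarrow> openin X V \<Longrightarrow> U \<subseteq> V \<Longrightarrow> \<nu> U \<le> \<nu> V"
    and "(\<And>U. U \<in> D \<Longrightarrow> openin X U) \<Longrightarrow> directed_family D \<Longrightarrow> \<nu> (\<Union>D) = (SUP U\<in>D. \<nu> U)"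
  using assms unfolding continuous_valuation_def by blast+

text \<open>
  Integrate both capacities, interpolate an additive functional, and evaluate it at indicator functions.
  The result is modular because the indicators of \<open>U\<close> and \<open>V\<close> and those of \<open>U \<union> V\<close> and \<open>U \<inter> V\<close> have the
  same sum.
\<close>

theorem capacity_sandwich:
  assumes g: "capacity_on X g" "supermodular_on X g"
    and sc: "\<And>D. (\<And>U. U \<in> D \<Longrightarrow> openin X U) \<Longrightarrow> directed_family D \<Longrightarrow> g (\<Union>D) \<le> (SUP U\<in>D. g U)"
    and h: "capacity_on X h" "submodular_on X h"
    and le: "\<And>U. openin X U \<Longrightarrow> g U \<le> h U"
  obtains \<mu> where "continuous_valuation X \<mu>" "\<And>U. openin X U \<Longrightarrow> g U \<le> \<mu> U"
    "\<And>U. openin X U \<Longrightarrow> \<mu> U \<le> h U"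
proof -
  interpret additive_cone "lsc_funs X"
    by unfold_locales (auto intro: lsc_funs_zero lsc_funs_add)
  have g0: "g {} = 0" and h0: "h {} = 0" using g h by (auto simp: capacity_on_def)
  have "subadditive (choquet h)"
    using h h0 by (auto simp: subadditive_def choquet_zero choquet_subadditive)
  moreover have "superadditive (choquet g)"
    using g by (auto simp: superadditive_def choquet_superadditive)
  moreover have "scott_continuous_on (lsc_funs X) (choquet g)"
    by (rule choquet_scott_continuous[OF g(1) sc])
  moreover have "choquet g f \<le> choquet h f" if "f \<in> lsc_funs X" for f
    unfolding choquet_def using that by (intro suminf_le le) (auto simp: lsc_funs_def)
  ultimately obtain q where q: "scott_continuous_on (lsc_funs X) q"
    and gq: "\<And>f. f \<in> lsc_funs X \<Longrightarrow> choquet g f \<le> q f"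
    and qh: "\<And>f. f \<in> lsc_funs X \<Longrightarrow> q f \<le> choquet h f"
    and add: "\<And>f h. f \<in> lsc_funs X \<Longrightarrow> h \<in> lsc_funs X \<Longrightarrow> q (\<lambda>x. f x + h x) = q f + q h"
    using functional_sandwich[of "choquet h" "choquet g"] by blast
  define \<mu> where "\<mu> = (\<lambda>U\<in>{U. openin X U}. q (ind U))"
  have \<mu>: "\<mu> U = q (ind U)" if "openin X U" for U using that by (simp add: \<mu>_def)
  have \<mu>_sup: "\<mu> U \<le> (SUP V\<in>D. \<mu> V)"
    if U: "openin X U" "U \<subseteq> \<Union>D" and D: "\<And>U. U \<in> D \<Longrightarrow> openin X U" "directed_family D" for U D
  proof -
    have "q (ind U) \<le> (SUP f\<in>ind ` D. q f)"
    proof (rule scott_continuousD[OF q])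
      fix d e :: "'a \<Rightarrow> nat" assume "d \<in> ind ` D" "e \<in> ind ` D"
      then obtain V W where VW: "V \<in> D" "W \<in> D" "d = ind V" "e = ind W" by auto
      then obtain Z where "Z \<in> D" "V \<subseteq> Z" "W \<subseteq> Z"
        using D(2) unfolding directed_family_def by blast
      then show "\<exists>c\<in>ind ` D. d \<le> c \<and> e \<le> c"
        using VW by (intro bexI[of _ "ind Z"]) (auto simp: le_fun_def of_bool_def)
    next
      fix x
      show "\<exists>d\<in>ind ` D. ind U x \<le> d x"
      proof (cases "x \<in> U")
        case True
        then show ?thesis using U(2) by (auto simp: of_bool_def)
      next
        case False
        then show ?thesis using D(2) by (auto simp: directed_family_def)
      qed
    qed (use U D in \<open>auto simp: lsc_funs_ind directed_family_def\<close>)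
    also have "\<dots> = (SUP V\<in>D. \<mu> V)"
      unfolding image_image by (rule SUP_cong) (simp_all add: \<mu> D(1))
    finally show ?thesis using U(1) by (simp add: \<mu>)
  qed
  have mono: "\<mu> U \<le> \<mu> V" if "openin X U" "openin X V" "U \<subseteq> V" for U V
    using \<mu>_sup[of U "{V}"] that by (simp add: directed_family_def)
  have g\<mu>: "g U \<le> \<mu> U" if "openin X U" for U
    using gq[OF lsc_funs_ind[OF that]] by (simp add: \<mu> that choquet_ind g0)
  have \<mu>h: "\<mu> U \<le> h U" if "openin X U" for U
    using qh[OF lsc_funs_ind[OF that]] by (simp add: \<mu> that choquet_ind h0)
  have "\<mu> U + \<mu> V = \<mu> (U \<union> V) + \<mu> (U \<inter> V)" if UV: "openin X U" "openin X V" for U V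
  proof -
    have "\<mu> U + \<mu> V = q (\<lambda>x. ind U x + ind V x)"
      using UV by (simp add: \<mu> add lsc_funs_ind)
    also have "(\<lambda>x. ind U x + ind V x) = (\<lambda>x. ind (U \<union> V) x + ind (U \<inter> V) x)"
      by (auto simp: of_bool_def)
    also have "q \<dots> = \<mu> (U \<union> V) + \<mu> (U \<inter> V)"
      using UV by (simp only: \<mu> add lsc_funs_ind openin_Un openin_Int)
    finally show ?thesis .
  qed
  moreover have "\<mu> {} = 0" using \<mu>h[of "{}"] h0 by simp
  moreover have "\<mu> (\<Union>D) = (SUP U\<in>D. \<mu> U)" if D: "\<forall>U\<in>D. openin X U" "directed_family D" for D
    using D by (intro antisym \<mu>_sup SUP_least mono) auto
  ultimately have "continuous_valuation X \<mu>"
    using mono by (auto simp: continuous_valuation_def \<mu>_def)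
  then show ?thesis using that g\<mu> \<mu>h by blast
qed

section \<open>The right adjoint of the preimage map\<close>

text \<open>
  The right adjoint of the preimage map, written through the downward closure so that properness gives
  openness at once.
\<close>

definition lower_image :: "'a topology \<Rightarrow> 'b topology \<Rightarrow> ('a \<Rightarrow> 'b) \<Rightarrow> 'a set \<Rightarrow> 'b set" where
  "lower_image X Y r U = topspace Y - down_closure Y (r ` (topspace X - U))"

lemma mem_lower_image:
  "y \<in> lower_image X Y r U \<longleftrightarrow>
     y \<in> topspace Y \<and> (\<forall>x\<in>topspace X. spec_le Y y (r x) \<longrightarrow> x \<in> U)"
  by (auto simp: lower_image_def down_closure_def)

lemma openin_lower_image:
  assumes "proper_cont_map X Y r" "openin X U"
  shows "openin Y (lower_image X Y r U)"
  using assms unfolding lower_image_def proper_cont_map_def by (auto intro!: openin_diff)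

text \<open>
  Principal upper sets are the compact saturated sets whose preimages are needed for the Scott-continuity
  of \<open>lower_image\<close>.
\<close>

lemma compactin_upset:
  assumes y: "y \<in> topspace Y"
  shows "compactin Y {z. spec_le Y y z}" "saturatedin Y {z. spec_le Y y z}"
proof -
  have refl: "spec_le Y y y" using y by (auto simp: spec_le_def)
  show "compactin Y {z. spec_le Y y z}"
    unfolding compactin_def
  proof (intro conjI allI impI)
    show "{z. spec_le Y y z} \<subseteq> topspace Y" by (auto simp: spec_le_def)
    fix \<U> assume \<U>: "(\<forall>U\<in>\<U>. openin Y U) \<and> {z. spec_le Y y z} \<subseteq> \<Union>\<U>"
    then obtain U where U: "U \<in> \<U>" "y \<in> U" using refl by blast
    then have "{z. spec_le Y y z} \<subseteq> U" using \<U> by (auto simp: spec_le_def)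
    then show "\<exists>\<F>. finite \<F> \<and> \<F> \<subseteq> \<U> \<and> {z. spec_le Y y z} \<subseteq> \<Union>\<F>"
      using U by (intro exI[of _ "{U}"]) auto
  qed
  show "saturatedin Y {z. spec_le Y y z}" by (auto simp: saturatedin_def spec_le_def)
qed

lemma directed_family_finite_bound:
  assumes "directed_family D" "finite F" "F \<subseteq> D"
  shows "\<exists>W\<in>D. \<Union>F \<subseteq> W"
  using assms(2,3)
proof (induction F)
  case empty
  then show ?case using assms(1) by (auto simp: directed_family_def)
next
  case (insert U F)
  then obtain W where W: "W \<in> D" "\<Union>F \<subseteq> W" by auto
  have "U \<in> D" using insert.prems by simp
  with W(1) obtain Z where "Z \<in> D" "U \<subseteq> Z" "W \<subseteq> Z"
    using assms(1) unfolding directed_family_def by metis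
  then show ?case using W(2) by (intro bexI[of _ Z]) auto
qed

text \<open>
  If \<open>y\<close> is in the left-hand side, the preimage of the upper set of \<open>y\<close> is a compact set covered by the
  directed family \<open>D\<close>, hence contained in one member.
\<close>

lemma lower_image_Union:
  assumes r: "proper_cont_map X Y r" and D: "\<And>U. U \<in> D \<Longrightarrow> openin X U" "directed_family D"
  shows "lower_image X Y r (\<Union>D) \<subseteq> \<Union>(lower_image X Y r ` D)"
proof
  fix y assume y: "y \<in> lower_image X Y r (\<Union>D)"
  then have yY: "y \<in> topspace Y" by (simp add: mem_lower_image)
  let ?K = "{x \<in> topspace X. r x \<in> {z. spec_le Y y z}}"
  have "compactin X ?K"
    using r compactin_upset[OF yY] by (auto simp only: proper_cont_map_def)
  moreover have "?K \<subseteq> \<Union>D" using y by (auto simp: mem_lower_image)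
  ultimately obtain F where F: "finite F" "F \<subseteq> D" "?K \<subseteq> \<Union>F"
    using compactinD[of X ?K D] D(1) by blast
  obtain W where W: "W \<in> D" "\<Union>F \<subseteq> W"
    using directed_family_finite_bound[OF D(2) F(1,2)] by (rule bexE)
  then have "?K \<subseteq> W" using F(3) by simp
  then have "y \<in> lower_image X Y r W"
    using yY by (auto simp: mem_lower_image)
  then show "y \<in> \<Union>(lower_image X Y r ` D)" using W(1) by auto
qed

section \<open>Compact and closed sets through ultrafilters\<close>

definition ultrafilter :: "'i filter \<Rightarrow> bool" where
  "ultrafilter F \<longleftrightarrow> F \<noteq> bot \<and> (\<forall>P. eventually P F \<or> eventually (\<lambda>x. \<not> P x) F)"

text \<open>
  A minimal proper filter is an ultrafilter: otherwise its restriction to a set that it does not decide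
  would be a smaller proper filter.
\<close>

lemma ex_ultrafilter:
  assumes "F \<noteq> bot"
  obtains G where "G \<le> F" "ultrafilter G"
proof -
  let ?A = "{G. G \<noteq> bot \<and> G \<le> F}"
  have "\<exists>m\<in>?A. \<forall>a\<in>?A. m \<ge> a \<longrightarrow> a = m"
  proof (rule predicate_Zorn)
    show "partial_order_on ?A (relation_of (\<lambda>a b. a \<ge> b) ?A)"
      by (rule partial_order_on_relation_ofI) auto
    fix C assume C: "C \<in> Chains (relation_of (\<lambda>a b. a \<ge> b) ?A)"
    then have CA: "C \<subseteq> ?A" and chain: "\<And>a b. a \<in> C \<Longrightarrow> b \<in> C \<Longrightarrow> a \<le> b \<or> b \<le> a"
      by (auto simp: Chains_def relation_of_def)
    show "\<exists>u\<in>?A. \<forall>a\<in>C. a \<ge> u"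
    proof (cases "C = {}")
      case False
      have "eventually P (Inf C) \<longleftrightarrow> (\<exists>b\<in>C. eventually P b)" for P
      proof (rule eventually_Inf_base[OF False])
        fix a b assume "a \<in> C" "b \<in> C"
        with chain[OF this] show "\<exists>x\<in>C. x \<le> inf a b" by auto
      qed
      then have "Inf C \<noteq> bot"
        using CA by (auto simp: trivial_limit_def)
      moreover have "Inf C \<le> F" using False CA by (auto intro: Inf_lower2)
      ultimately show ?thesis by (intro bexI[of _ "Inf C"]) (auto intro: Inf_lower)
    qed (use assms in auto)
  qed
  then obtain G where G: "G \<noteq> bot" "G \<le> F" and min: "\<And>H. H \<noteq> bot \<Longrightarrow> H \<le> F \<Longrightarrow> H \<le> G \<Longrightarrow> H = G"
    by blast
  have "eventually P G \<or> eventually (\<lambda>x. \<not> P x) G" for P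
  proof (cases "inf G (principal {x. P x}) = bot")
    case True
    then show ?thesis by (simp add: trivial_limit_def eventually_inf_principal)
  next
    case False
    then have "inf G (principal {x. P x}) = G"
      using G(2) by (intro min) (auto intro: le_infI1)
    then have "G \<le> principal {x. P x}" by (metis inf.orderI)
    then show ?thesis by (simp add: le_principal)
  qed
  then show ?thesis using that G by (auto simp: ultrafilter_def)
qed

text \<open>
  The compactness of the extended half-line: a number strictly between the lower and the upper limit
  would be decided by the ultrafilter.
\<close>

lemma ultrafilter_tendsto_Liminf:
  fixes a :: "'i \<Rightarrow> ennreal"
  assumes F: "ultrafilter F"
  shows "(a \<longlongrightarrow> Liminf F a) F"
proof -
  have nb: "F \<noteq> bot" using F by (simp add: ultrafilter_def)
  have "Limsup F a \<le> Liminf F a"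
  proof (rule ccontr)
    assume "\<not> ?thesis"
    then obtain s where s: "Liminf F a < s" "s < Limsup F a" by (auto simp: not_le dest: dense)
    from F consider "eventually (\<lambda>i. a i \<le> s) F" | "eventually (\<lambda>i. \<not> a i \<le> s) F"
      unfolding ultrafilter_def by blast
    then show False
    proof cases
      case 1
      then show False using Limsup_bounded[of a s F] s by auto
    next
      case 2
      then have "s \<le> Liminf F a" by (intro Liminf_bounded) (auto elim: eventually_mono)
      then show False using s by auto
    qed
  qed
  then have "Limsup F a = Liminf F a" using Liminf_le_Limsup[OF nb] by (rule antisym)
  then show ?thesis by (simp add: tendsto_iff_Liminf_eq_Limsup nb)
qed

lemma compactin_imp_ultrafilter_limit:
  assumes K: "compactin T K" and F: "ultrafilter F" "eventually (\<lambda>i. f i \<in> K) F"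
  obtains x where "x \<in> K" "limitin T f x F"
proof -
  have "\<exists>x\<in>K. limitin T f x F"
  proof (rule ccontr)
    assume no: "\<not> ?thesis"
    let ?\<U> = "{U. openin T U \<and> \<not> eventually (\<lambda>i. f i \<in> U) F}"
    have "K \<subseteq> \<Union>?\<U>"
      using no K by (auto simp: limitin_def compactin_def subset_iff)
    then obtain \<F> where \<F>: "finite \<F>" "\<F> \<subseteq> ?\<U>" "K \<subseteq> \<Union>\<F>"
      using compactinD[OF K, of ?\<U>] by blast
    have "eventually (\<lambda>i. \<forall>U\<in>\<F>. f i \<notin> U) F"
      using \<F> F(1) by (intro eventually_ball_finite) (auto simp: ultrafilter_def)
    with F(2) have "eventually (\<lambda>i. False) F"
      by eventually_elim (use \<F>(3) in auto)
    then show False using F(1) by (simp add: ultrafilter_def trivial_limit_def)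
  qed
  then show ?thesis using that by blast
qed

lemma compactin_if_ultrafilter_limits:
  assumes K: "K \<subseteq> topspace T"
    and lim: "\<And>F. ultrafilter F \<Longrightarrow> eventually (\<lambda>x. x \<in> K) F \<Longrightarrow> \<exists>x\<in>K. limitin T (\<lambda>x. x) x F"
  shows "compactin T K"
  unfolding compactin_def
proof (intro conjI K allI impI, rule ccontr)
  fix \<U> assume \<U>: "(\<forall>U\<in>\<U>. openin T U) \<and> K \<subseteq> \<Union>\<U>"
    and no: "\<not> (\<exists>\<F>. finite \<F> \<and> \<F> \<subseteq> \<U> \<and> K \<subseteq> \<Union>\<F>)"
  have "(INF U\<in>\<U>. principal (K - U)) \<noteq> bot"
  proof (rule INF_filter_not_bot)
    fix \<F> assume \<F>: "\<F> \<subseteq> \<U>" "finite \<F>"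
    then obtain x where "x \<in> K" "x \<notin> \<Union>\<F>" using no by blast
    then have "(\<Inter>U\<in>\<F>. K - U) \<noteq> {}" by auto
    then show "(INF U\<in>\<F>. principal (K - U)) \<noteq> bot"
      by (simp only: INF_principal_finite[OF \<F>(2)] principal_eq_bot_iff not_False_eq_True)
  qed
  then obtain G where G: "G \<le> (INF U\<in>\<U>. principal (K - U))" "ultrafilter G"
    by (rule ex_ultrafilter)
  have ev: "eventually (\<lambda>x. x \<in> K - U) G" if "U \<in> \<U>" for U
    using order_trans[OF G(1) INF_lower[OF that]] by (simp add: le_principal)
  have "\<U> \<noteq> {}"
  proof
    assume "\<U> = {}"
    then have "K \<subseteq> \<Union>{}" using \<U> by simp
    then show False using no by (metis empty_subsetI finite.emptyI)
  qed
  then obtain V where "V \<in> \<U>" by auto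
  from ev[OF this] have "eventually (\<lambda>x. x \<in> K) G" by (rule eventually_mono) auto
  from lim[OF G(2) this] obtain x where x: "x \<in> K" "limitin T (\<lambda>x. x) x G" by blast
  then obtain U where U: "U \<in> \<U>" "x \<in> U" using \<U> by blast
  then have "eventually (\<lambda>x. x \<in> U) G" using x(2) \<U> by (auto simp: limitin_def)
  with ev[OF U(1)] have "eventually (\<lambda>x. False) G" by eventually_elim auto
  then show False using G(2) by (simp add: ultrafilter_def trivial_limit_def)
qed

lemma closedin_if_ultrafilter_limits:
  assumes C: "C \<subseteq> topspace T"
    and lim: "\<And>F x. ultrafilter F \<Longrightarrow> eventually (\<lambda>x. x \<in> C) F \<Longrightarrow> limitin T (\<lambda>x. x) x F \<Longrightarrow> x \<in> C"
  shows "closedin T C"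
proof -
  have "\<exists>N. openin T N \<and> x \<in> N \<and> N \<subseteq> topspace T - C" if x: "x \<in> topspace T - C" for x
  proof (rule ccontr)
    assume no: "\<not> ?thesis"
    let ?\<N> = "{N. openin T N \<and> x \<in> N}"
    have "(INF N\<in>?\<N>. principal (N \<inter> C)) \<noteq> bot"
    proof (rule INF_filter_not_bot)
      fix \<F> assume \<F>: "\<F> \<subseteq> ?\<N>" "finite \<F>"
      define N where "N = \<Inter>(insert (topspace T) \<F>)"
      have "openin T N"
        unfolding N_def using \<F> by (intro openin_Inter) auto
      moreover have "x \<in> N" using \<F> x by (auto simp: N_def)
      ultimately have "\<not> N \<subseteq> topspace T - C" using no by blast
      then have "(\<Inter>M\<in>\<F>. M \<inter> C) \<noteq> {}" by (auto simp: N_def)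
      then show "(INF N\<in>\<F>. principal (N \<inter> C)) \<noteq> bot"
        by (simp only: INF_principal_finite[OF \<F>(2)] principal_eq_bot_iff not_False_eq_True)
    qed
    then obtain G where G: "G \<le> (INF N\<in>?\<N>. principal (N \<inter> C))" "ultrafilter G"
      by (rule ex_ultrafilter)
    have ev: "eventually (\<lambda>z. z \<in> N \<inter> C) G" if "openin T N" "x \<in> N" for N
      using order_trans[OF G(1) INF_lower[of N]] that by (simp add: le_principal)
    have "eventually (\<lambda>z. z \<in> C) G"
      using ev[of "topspace T"] x by (auto elim: eventually_mono)
    moreover have "limitin T (\<lambda>z. z) x G"
      unfolding limitin_def
    proof (intro conjI allI impI)
      fix N assume "openin T N \<and> x \<in> N"
      then have "eventually (\<lambda>z. z \<in> N \<inter> C) G" by (intro ev) auto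
      then show "eventually (\<lambda>z. z \<in> N) G" by (rule eventually_mono) auto
    qed (use x in auto)
    ultimately show False using lim G(2) x by blast
  qed
  then have "openin T (topspace T - C)" by (subst openin_subopen) blast
  then show ?thesis using C by (simp add: closedin_def)
qed

section \<open>Limits of valuations and properness\<close>

text \<open>
  The pointwise limit \<open>h\<close> of the \<open>m i\<close> is a modular capacity, and \<open>g\<close>, the composition of \<open>\<nu>\<close> with
  \<open>lower_image\<close>, is a Scott-continuous supermodular capacity below it; \<open>\<mu>\<close> is taken in between. Only
  \<open>g \<le> \<mu>\<close> is needed for \<open>\<nu>\<close> to lie below the image of \<open>\<mu>\<close>, and only \<open>\<mu> \<le> h\<close> for convergence.
\<close>

lemma valuation_ultralimit:
  assumes F: "ultrafilter F" and r: "proper_cont_map X Y r" and \<nu>: "continuous_valuation Y \<nu>"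
    and m: "eventually (\<lambda>i. continuous_valuation X (m i) \<and>
      (\<forall>V. openin Y V \<longrightarrow> n i V \<le> m i {x \<in> topspace X. r x \<in> V})) F"
    and n: "\<And>V s. openin Y V \<Longrightarrow> s < \<nu> V \<Longrightarrow> eventually (\<lambda>i. s < n i V) F"
  shows "\<exists>\<mu>. continuous_valuation X \<mu> \<and>
    (\<forall>V. openin Y V \<longrightarrow> \<nu> V \<le> \<mu> {x \<in> topspace X. r x \<in> V}) \<and>
    (\<forall>U s. openin X U \<and> s < \<mu> U \<longrightarrow> eventually (\<lambda>i. s < m i U) F)"
proof -
  define h where "h U = Liminf F (\<lambda>i. m i U)" for U
  define g where "g U = \<nu> (lower_image X Y r U)" for U
  have nb: "F \<noteq> bot" using F by (simp add: ultrafilter_def)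
  have cont: "continuous_map X Y r" using r by (simp add: proper_cont_map_def)
  have lim: "((\<lambda>i. m i U) \<longlongrightarrow> h U) F" for U
    unfolding h_def by (rule ultrafilter_tendsto_Liminf[OF F])
  have mv: "eventually (\<lambda>i. continuous_valuation X (m i)) F"
    using m by (rule eventually_mono) auto
  note \<nu>D = continuous_valuationD[OF \<nu>]
  note op = openin_lower_image[OF r]
  have gh: "g U \<le> h U" if U: "openin X U" for U
    unfolding h_def le_Liminf_iff
  proof (intro allI impI)
    fix s assume "s < g U"
    then have "eventually (\<lambda>i. s < n i (lower_image X Y r U)) F"
      unfolding g_def by (rule n[OF op[OF U]])
    then show "eventually (\<lambda>i. s < m i U) F"
      using m
    proof eventually_elim
      case (elim i)
      let ?W = "{x \<in> topspace X. r x \<in> lower_image X Y r U}"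
      have W: "openin X ?W" using cont op[OF U] by (rule openin_continuous_map_preimage)
      have "?W \<subseteq> U"
        by (auto simp: mem_lower_image spec_le_def)
      with elim U W have "m i ?W \<le> m i U" by (intro continuous_valuationD(3)) auto
      moreover have "n i (lower_image X Y r U) \<le> m i ?W" using elim op[OF U] by blast
      ultimately show ?case using elim(1) by (meson less_le_trans)
    qed
  qed
  have h_mono: "h U \<le> h V" if "openin X U" "openin X V" "U \<subseteq> V" for U V
    unfolding h_def
    by (rule Liminf_mono, rule eventually_mono[OF mv]) (use continuous_valuationD(3) that in blast)
  have h0: "h {} = 0"
  proof -
    have "((\<lambda>i. m i {}) \<longlongrightarrow> 0) F"
      by (rule tendsto_eventually, rule eventually_mono[OF mv]) (rule continuous_valuationD(1))
    then show ?thesis using lim nb by (blast intro: tendsto_unique)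
  qed
  have h_mod: "h U + h V = h (U \<union> V) + h (U \<inter> V)" if UV: "openin X U" "openin X V" for U V
  proof (rule tendsto_unique[OF nb])
    show "((\<lambda>i. m i U + m i V) \<longlongrightarrow> h U + h V) F" by (intro tendsto_add lim)
    have "((\<lambda>i. m i (U \<union> V) + m i (U \<inter> V)) \<longlongrightarrow> h (U \<union> V) + h (U \<inter> V)) F" by (intro tendsto_add lim)
    moreover have "eventually (\<lambda>i. m i (U \<union> V) + m i (U \<inter> V) = m i U + m i V) F"
      using mv by (rule eventually_mono) (simp add: continuous_valuationD(2)[OF _ UV])
    ultimately show "((\<lambda>i. m i U + m i V) \<longlongrightarrow> h (U \<union> V) + h (U \<inter> V)) F"
      by (rule Lim_transform_eventually)
  qed
  have li_mono: "lower_image X Y r U \<subseteq> lower_image X Y r V" if "U \<subseteq> V" for U V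
    using that by (auto simp: mem_lower_image subset_iff)
  have g_mono: "g U \<le> g V" if "openin X U" "openin X V" "U \<subseteq> V" for U V
    unfolding g_def by (intro \<nu>D(3) op that li_mono)
  \<comment> \<open>The lower image of the empty set consists of the points below no point of the image of
    \<open>r\<close>. That \<open>\<nu>\<close> vanishes there comes from the existence of the \<open>m i\<close>.\<close>
  have g0: "g {} = 0" using gh[of "{}"] h0 by simp
  have g_super: "g U + g V \<le> g (U \<union> V) + g (U \<inter> V)" if UV: "openin X U" "openin X V" for U V
  proof -
    have "g U + g V = \<nu> (lower_image X Y r U \<union> lower_image X Y r V) +
        \<nu> (lower_image X Y r U \<inter> lower_image X Y r V)"
      unfolding g_def by (intro \<nu>D(2) op UV)
    also have "lower_image X Y r U \<inter> lower_image X Y r V = lower_image X Y r (U \<inter> V)"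
      by (auto simp: mem_lower_image)
    also have "\<nu> (lower_image X Y r U \<union> lower_image X Y r V) \<le> \<nu> (lower_image X Y r (U \<union> V))"
      by (intro \<nu>D(3) op openin_Un UV Un_least li_mono) auto
    finally show ?thesis by (simp add: g_def add_right_mono)
  qed
  have g_sc: "g (\<Union>D) \<le> (SUP U\<in>D. g U)"
    if D: "\<And>U. U \<in> D \<Longrightarrow> openin X U" "directed_family D" for D
  proof -
    have "g (\<Union>D) \<le> \<nu> (\<Union>(lower_image X Y r ` D))"
      unfolding g_def using D by (intro \<nu>D(3) lower_image_Union r op openin_Union) (auto intro: op)
    also have "\<dots> = (SUP W\<in>lower_image X Y r ` D. \<nu> W)"
    proof (rule \<nu>D(4))
      show "directed_family (lower_image X Y r ` D)"
        unfolding directed_family_def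
      proof (intro conjI ballI)
        fix A B assume "A \<in> lower_image X Y r ` D" "B \<in> lower_image X Y r ` D"
        then obtain U V where UV: "U \<in> D" "V \<in> D" "A = lower_image X Y r U" "B = lower_image X Y r V"
          by auto
        then obtain W where "W \<in> D" "U \<subseteq> W" "V \<subseteq> W"
          using D(2) unfolding directed_family_def by metis
        then show "\<exists>C\<in>lower_image X Y r ` D. A \<subseteq> C \<and> B \<subseteq> C"
          using UV by (intro bexI[of _ "lower_image X Y r W"]) (auto simp: li_mono)
      qed (use D(2) in \<open>auto simp: directed_family_def\<close>)
    qed (use D in \<open>auto intro: op\<close>)
    finally show ?thesis by (simp add: g_def image_image)
  qed
  have "capacity_on X g" "supermodular_on X g" "capacity_on X h" "submodular_on X h"
    using g0 g_mono g_super h0 h_mono h_mod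
    by (simp_all add: capacity_on_def supermodular_on_def submodular_on_def)
  then obtain \<mu> where \<mu>: "continuous_valuation X \<mu>" "\<And>U. openin X U \<Longrightarrow> g U \<le> \<mu> U"
    "\<And>U. openin X U \<Longrightarrow> \<mu> U \<le> h U"
    using capacity_sandwich[of X g h] g_sc gh by metis
  show ?thesis
  proof (intro exI[of _ \<mu>] conjI \<mu>(1) allI impI; (elim conjE)?)
    fix V assume V: "openin Y V"
    let ?W = "{x \<in> topspace X. r x \<in> V}"
    have W: "openin X ?W" using cont V by (rule openin_continuous_map_preimage)
    have "V \<subseteq> lower_image X Y r ?W"
      using openin_subset[OF V] V by (auto simp: mem_lower_image spec_le_def)
    then have "\<nu> V \<le> g ?W"
      unfolding g_def by (intro \<nu>D(3) V op W)
    also have "\<dots> \<le> \<mu> ?W" by (rule \<mu>(2)[OF W])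
    finally show "\<nu> V \<le> \<mu> ?W" .
  next
    fix U s assume U: "openin X U" and "s < \<mu> U"
    then have "s < Liminf F (\<lambda>i. m i U)" using \<mu>(3)[OF U] unfolding h_def by (rule_tac less_le_trans)
    then show "eventually (\<lambda>i. s < m i U) F" by (rule less_LiminfD)
  qed
qed

text \<open>
  With \<open>A\<close> an interval \<open>{0..top}\<close>, \<open>{0..1}\<close> or \<open>{1..1}\<close> this is the space of all, of subprobability or
  of probability valuations, so one proof serves all three.
\<close>

definition mass_space :: "ennreal set \<Rightarrow> 'a topology \<Rightarrow> ('a set \<Rightarrow> ennreal) topology" where
  "mass_space A X = subtopology (valuation_space X) {\<nu>. \<nu> (topspace X) \<in> A}"

lemma topspace_mass_space:
  "topspace (mass_space A X) = {\<nu>. continuous_valuation X \<nu> \<and> \<nu> (topspace X) \<in> A}"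
  by (auto simp: mass_space_def topspace_valuation_space)

lemma openin_subbasic:
  assumes U: "openin X U"
  shows "openin (mass_space A X) {\<nu> \<in> topspace (mass_space A X). s < \<nu> U}"
proof (cases "s = \<infinity>")
  case False
  define t where "t = enn2real s"
  have t: "s = ennreal t" "0 \<le> t" using False by (simp_all add: t_def less_top)
  have "openin (valuation_space X) {\<nu>. continuous_valuation X \<nu> \<and> \<nu> U > ennreal t}"
    unfolding valuation_space_def using U t(2) by (intro topology_generated_by_Basis) auto
  then have "openin (mass_space A X)
      ({\<nu>. continuous_valuation X \<nu> \<and> \<nu> U > ennreal t} \<inter> {\<nu>. \<nu> (topspace X) \<in> A})"
    unfolding mass_space_def openin_subtopology by blast
  moreover have "{\<nu>. continuous_valuation X \<nu> \<and> \<nu> U > ennreal t} \<inter> {\<nu>. \<nu> (topspace X) \<in> A} =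
      {\<nu> \<in> topspace (mass_space A X). s < \<nu> U}"
    by (auto simp: topspace_mass_space t)
  ultimately show ?thesis by simp
qed simp

text \<open>
  Convergence is pointwise and one-sided, so that a limit may always be replaced by a smaller valuation
  in the space. All topological arguments below use the weak topology only through this description.
\<close>

lemma limitin_mass_space:
  "limitin (mass_space A X) m \<mu> F \<longleftrightarrow>
     \<mu> \<in> topspace (mass_space A X) \<and>
     eventually (\<lambda>i. m i \<in> topspace (mass_space A X)) F \<and>
     (\<forall>U s. openin X U \<and> s < \<mu> U \<longrightarrow> eventually (\<lambda>i. s < m i U) F)" (is "?L \<longleftrightarrow> ?R")
proof
  assume L: ?L
  have "eventually (\<lambda>i. s < m i U) F" if "openin X U" "s < \<mu> U" for U s
  proof -
    have "\<mu> \<in> {\<nu> \<in> topspace (mass_space A X). s < \<nu> U}"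
      using L that by (simp add: limitin_def)
    then have "eventually (\<lambda>i. m i \<in> {\<nu> \<in> topspace (mass_space A X). s < \<nu> U}) F"
      using L openin_subbasic[OF that(1)] unfolding limitin_def by blast
    then show ?thesis by (rule eventually_mono) auto
  qed
  moreover have "\<mu> \<in> topspace (mass_space A X)"
    "eventually (\<lambda>i. m i \<in> topspace (mass_space A X)) F"
    using L unfolding limitin_def by blast+
  ultimately show ?R by blast
next
  assume R: ?R
  have ev: "eventually (\<lambda>i. continuous_valuation X (m i)) F"
    using R by (auto simp: topspace_mass_space elim: eventually_mono)
  have "eventually (\<lambda>i. m i \<in> N) F"
    if "generate_topology_on (insert {\<nu>. continuous_valuation X \<nu>}
          {{\<nu>. continuous_valuation X \<nu> \<and> \<nu> U > ennreal r} | U r. openin X U \<and> 0 \<le> r}) N" "\<mu> \<in> N" for N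
    using that
  proof induction
    case (Int a b)
    then show ?case by (auto intro: eventually_conj)
  next
    case (UN K)
    then obtain k where "k \<in> K" "eventually (\<lambda>i. m i \<in> k) F" by auto
    then show ?case by (auto elim!: eventually_mono)
  next
    case (Basis S)
    then consider "S = {\<nu>. continuous_valuation X \<nu>}" |
      U r where "S = {\<nu>. continuous_valuation X \<nu> \<and> \<nu> U > ennreal r}" "openin X U" by auto
    then show ?case
    proof cases
      case 1
      then show ?thesis using ev by simp
    next
      case 2
      then have "eventually (\<lambda>i. ennreal r < m i U) F" using R Basis.prems by auto
      with ev show ?thesis by eventually_elim (simp add: 2)
    qed
  qed simp
  then have lim: "eventually (\<lambda>i. m i \<in> N) F" if "openin (valuation_space X) N" "\<mu> \<in> N" for N
    using that unfolding valuation_space_def openin_topology_generated_by_iff by blast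
  show ?L
    unfolding limitin_def
  proof (intro conjI allI impI)
    fix N assume N: "openin (mass_space A X) N \<and> \<mu> \<in> N"
    then obtain M where M: "openin (valuation_space X) M" "N = M \<inter> {\<nu>. \<nu> (topspace X) \<in> A}"
      unfolding mass_space_def openin_subtopology by blast
    have "eventually (\<lambda>i. m i \<in> M) F" using N M by (intro lim) auto
    moreover have "eventually (\<lambda>i. m i \<in> topspace (mass_space A X)) F" using R by blast
    ultimately show "eventually (\<lambda>i. m i \<in> N) F"
      by eventually_elim (simp add: M topspace_mass_space)
  qed (use R in blast)
qed

text \<open>
  The specialization preorder is convergence of a constant family, which turns the preceding
  description of limits into one of the order.
\<close>

lemma spec_le_iff_limitin:
  "spec_le T x y \<longleftrightarrow> y \<in> topspace T \<and> limitin T (\<lambda>_. y) x (principal {()})"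
  by (auto simp: spec_le_def limitin_def eventually_principal)

lemma spec_le_mass_space:
  "spec_le (mass_space A X) \<mu> \<nu> \<longleftrightarrow>
     \<mu> \<in> topspace (mass_space A X) \<and> \<nu> \<in> topspace (mass_space A X) \<and>
     (\<forall>U. openin X U \<longrightarrow> \<mu> U \<le> \<nu> U)"
  unfolding spec_le_iff_limitin limitin_mass_space eventually_principal
  by (auto simp: not_less[symmetric])

lemma valuation_map_in_topspace:
  assumes f: "continuous_map X Y f" and \<nu>: "\<nu> \<in> topspace (mass_space A X)"
  shows "valuation_map X Y f \<nu> \<in> topspace (mass_space A Y)"
proof -
  let ?pre = "\<lambda>V. {x \<in> topspace X. f x \<in> V}"
  let ?\<mu> = "valuation_map X Y f \<nu>"
  have v: "continuous_valuation X \<nu>" and mass: "\<nu> (topspace X) \<in> A"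
    using \<nu> by (auto simp: topspace_mass_space)
  note \<nu>D = continuous_valuationD[OF v]
  have op: "openin X (?pre V)" if "openin Y V" for V
    using f that by (rule openin_continuous_map_preimage)
  have eq: "?\<mu> V = \<nu> (?pre V)" if "openin Y V" for V
    using that by (simp add: valuation_map_def)
  have "?pre (topspace Y) = topspace X" using f by (auto simp: continuous_map_def)
  then have "?\<mu> (topspace Y) \<in> A" using mass by (simp add: eq)
  moreover have "continuous_valuation Y ?\<mu>"
    unfolding continuous_valuation_def
  proof (intro conjI allI impI)
    show "?\<mu> \<in> extensional {U. openin Y U}" by (simp add: valuation_map_def)
    show "?\<mu> {} = 0" using \<nu>D(1) by (simp add: eq)
  next
    fix U V assume UV: "openin Y U \<and> openin Y V"
    have pre: "?pre (U \<union> V) = ?pre U \<union> ?pre V" "?pre (U \<inter> V) = ?pre U \<inter> ?pre V" by auto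
    have "?\<mu> (U \<union> V) + ?\<mu> (U \<inter> V) = \<nu> (?pre U \<union> ?pre V) + \<nu> (?pre U \<inter> ?pre V)"
      using eq[of "U \<union> V"] eq[of "U \<inter> V"] UV unfolding pre by (simp add: openin_Un openin_Int)
    also have "\<dots> = ?\<mu> U + ?\<mu> V"
      using \<nu>D(2)[OF op op, of U V] UV by (simp add: eq)
    finally show "?\<mu> U + ?\<mu> V = ?\<mu> (U \<union> V) + ?\<mu> (U \<inter> V)" ..
  next
    fix U V assume UV: "openin Y U \<and> openin Y V \<and> U \<subseteq> V"
    then show "?\<mu> U \<le> ?\<mu> V" using \<nu>D(3)[OF op op, of U V] by (auto simp: eq)
  next
    fix D assume D: "(\<forall>U\<in>D. openin Y U) \<and> directed_family D"
    have "?\<mu> (\<Union>D) = \<nu> (\<Union>(?pre ` D))"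
      using D by (subst eq) (auto intro: arg_cong[where f = \<nu>])
    also have "\<dots> = (SUP W\<in>?pre ` D. \<nu> W)"
    proof (rule \<nu>D(4))
      show "directed_family (?pre ` D)"
        unfolding directed_family_def
      proof (intro conjI ballI)
        fix P Q assume "P \<in> ?pre ` D" "Q \<in> ?pre ` D"
        then obtain U V where UV: "U \<in> D" "V \<in> D" "P = ?pre U" "Q = ?pre V" by auto
        then obtain W where "W \<in> D" "U \<subseteq> W" "V \<subseteq> W"
          using D unfolding directed_family_def by metis
        then show "\<exists>R\<in>?pre ` D. P \<subseteq> R \<and> Q \<subseteq> R"
          using UV by (intro bexI[of _ "?pre W"]) auto
      qed (use D in \<open>auto simp: directed_family_def\<close>)
    qed (use D op in auto)
    also have "\<dots> = (SUP U\<in>D. ?\<mu> U)"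
      unfolding image_image using D by (intro SUP_cong) (auto simp: eq)
    finally show "?\<mu> (\<Union>D) = (SUP U\<in>D. ?\<mu> U)" .
  qed
  ultimately show ?thesis by (simp add: topspace_mass_space)
qed

lemma continuous_map_if_limits:
  assumes "\<And>x. x \<in> topspace S \<Longrightarrow> f x \<in> topspace T"
    and "\<And>F x. limitin S (\<lambda>x. x) x F \<Longrightarrow> limitin T f (f x) F"
  shows "continuous_map S T f"
  unfolding continuous_map_def
proof (intro conjI allI impI)
  show "f \<in> topspace S \<rightarrow> topspace T" using assms(1) by blast
  fix U assume U: "openin T U"
  have "\<exists>N. openin S N \<and> x \<in> N \<and> N \<subseteq> {x \<in> topspace S. f x \<in> U}"
    if x: "x \<in> topspace S" "f x \<in> U" for x
  proof -
    have "limitin S (\<lambda>x. x) x (nhdsin S x)"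
      using x(1) by (auto simp: limitin_def eventually_nhdsin)
    from assms(2)[OF this] have "eventually (\<lambda>y. f y \<in> U) (nhdsin S x)"
      using U x(2) by (simp add: limitin_def)
    then obtain N where N: "openin S N" "x \<in> N" "\<forall>y\<in>N. f y \<in> U"
      using x(1) by (auto simp: eventually_nhdsin)
    then show ?thesis using openin_subset[OF N(1)] by blast
  qed
  then show "openin S {x \<in> topspace S. f x \<in> U}" by (subst openin_subopen) auto
qed

lemma continuous_valuation_map:
  assumes f: "continuous_map X Y f"
  shows "continuous_map (mass_space A X) (mass_space A Y) (valuation_map X Y f)"
proof (rule continuous_map_if_limits)
  fix F \<mu> assume L: "limitin (mass_space A X) (\<lambda>\<nu>. \<nu>) \<mu> F"
  show "limitin (mass_space A Y) (valuation_map X Y f) (valuation_map X Y f \<mu>) F"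
    unfolding limitin_mass_space
  proof (intro conjI allI impI)
    show "valuation_map X Y f \<mu> \<in> topspace (mass_space A Y)"
      using L by (auto simp: limitin_mass_space intro: valuation_map_in_topspace f)
    have "eventually (\<lambda>\<nu>. \<nu> \<in> topspace (mass_space A X)) F"
      using L by (simp add: limitin_mass_space)
    then show "eventually (\<lambda>\<nu>. valuation_map X Y f \<nu> \<in> topspace (mass_space A Y)) F"
      by (rule eventually_mono) (rule valuation_map_in_topspace[OF f])
    fix V s assume V: "openin Y V \<and> s < valuation_map X Y f \<mu> V"
    let ?W = "{x \<in> topspace X. f x \<in> V}"
    have "openin X ?W" using f V by (auto intro: openin_continuous_map_preimage)
    moreover have "s < \<mu> ?W" using V by (auto simp: valuation_map_def)
    ultimately have "eventually (\<lambda>\<nu>. s < \<nu> ?W) F"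
      using L unfolding limitin_mass_space by blast
    then show "eventually (\<lambda>\<nu>. s < valuation_map X Y f \<nu> V) F"
      using V by (simp add: valuation_map_def)
  qed
qed (rule valuation_map_in_topspace[OF f])

text \<open>
  The two ends of the interval are controlled from opposite sides: the mass of \<open>\<mu>\<close> is at least that of
  \<open>\<nu>\<close>, hence at least \<open>l\<close>, and it cannot exceed \<open>u\<close> because \<open>m i\<close> would exceed \<open>u\<close> eventually.
\<close>

lemma valuation_map_ultralimit:
  assumes F: "ultrafilter F" and r: "proper_cont_map X Y r"
    and n: "limitin (mass_space {l..u} Y) n \<nu> F"
    and m: "eventually (\<lambda>i. m i \<in> topspace (mass_space {l..u} X) \<and>
      spec_le (mass_space {l..u} Y) (n i) (valuation_map X Y r (m i))) F"
  obtains \<mu> where "limitin (mass_space {l..u} X) m \<mu> F"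
    "spec_le (mass_space {l..u} Y) \<nu> (valuation_map X Y r \<mu>)"
proof -
  have cont: "continuous_map X Y r" using r by (simp add: proper_cont_map_def)
  have \<nu>: "continuous_valuation Y \<nu>" "l \<le> \<nu> (topspace Y)"
    using n by (simp_all add: limitin_mass_space topspace_mass_space)
  have m': "eventually (\<lambda>i. continuous_valuation X (m i) \<and>
      (\<forall>V. openin Y V \<longrightarrow> n i V \<le> m i {x \<in> topspace X. r x \<in> V})) F"
    using m by (rule eventually_mono)
      (auto simp: topspace_mass_space spec_le_mass_space valuation_map_def)
  have n': "eventually (\<lambda>i. s < n i V) F" if "openin Y V" "s < \<nu> V" for V s
    using n that unfolding limitin_mass_space by blast
  obtain \<mu> where \<mu>: "continuous_valuation X \<mu>"
    "\<forall>V. openin Y V \<longrightarrow> \<nu> V \<le> \<mu> {x \<in> topspace X. r x \<in> V}"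
    "\<forall>U s. openin X U \<and> s < \<mu> U \<longrightarrow> eventually (\<lambda>i. s < m i U) F"
    using valuation_ultralimit[OF F r \<nu>(1) m' n'] by auto
  have "{x \<in> topspace X. r x \<in> topspace Y} = topspace X"
    using cont by (auto simp: continuous_map_def)
  then have "l \<le> \<mu> (topspace X)" using \<nu>(2) \<mu>(2)[rule_format, of "topspace Y"] by simp
  moreover have "\<mu> (topspace X) \<le> u"
  proof (rule ccontr)
    assume "\<not> ?thesis"
    then have "eventually (\<lambda>i. u < m i (topspace X)) F" by (intro \<mu>(3)[rule_format]) auto
    with m have "eventually (\<lambda>i. False) F"
      by eventually_elim (auto simp: topspace_mass_space)
    then show False using F by (simp add: ultrafilter_def trivial_limit_def)
  qed
  ultimately have \<mu>_top: "\<mu> \<in> topspace (mass_space {l..u} X)"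
    using \<mu>(1) by (simp add: topspace_mass_space)
  show ?thesis
  proof (rule that)
    show "limitin (mass_space {l..u} X) m \<mu> F"
      unfolding limitin_mass_space
    proof (intro conjI \<mu>_top \<mu>(3))
      show "eventually (\<lambda>i. m i \<in> topspace (mass_space {l..u} X)) F"
        using m by (rule eventually_mono) (rule conjunct1)
    qed
    show "spec_le (mass_space {l..u} Y) \<nu> (valuation_map X Y r \<mu>)"
      unfolding spec_le_mass_space
      using n valuation_map_in_topspace[OF cont \<mu>_top] \<mu>(2)
      by (simp add: limitin_mass_space valuation_map_def)
  qed
qed

text \<open>
  For closedness, an ultrafilter on \<open>\<down>f[C]\<close> with limit \<open>\<nu>\<close> is given, and \<open>m \<nu>'\<close> is a choice of an element of
  \<open>C\<close> with image above \<open>\<nu>'\<close>. For compactness, an ultrafilter on the preimage of \<open>Q\<close> is given, its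
  image has a limit in \<open>Q\<close>, and the choice is the identity.
\<close>

theorem proper_valuation_map:
  assumes r: "proper_cont_map X Y r"
  shows "proper_cont_map (mass_space {l..u} X) (mass_space {l..u} Y) (valuation_map X Y r)"
    (is "proper_cont_map ?VX ?VY ?f")
  unfolding proper_cont_map_def
proof (intro conjI allI impI)
  have r_cont: "continuous_map X Y r" using r by (simp add: proper_cont_map_def)
  show cont: "continuous_map ?VX ?VY ?f" by (rule continuous_valuation_map[OF r_cont])
  {
    fix C assume C: "closedin ?VX C"
    show "closedin ?VY (down_closure ?VY (?f ` C))"
    proof (rule closedin_if_ultrafilter_limits)
      show "down_closure ?VY (?f ` C) \<subseteq> topspace ?VY"
        by (auto simp: down_closure_def spec_le_def)
      fix F \<nu> assume F: "ultrafilter F" and ev: "eventually (\<lambda>\<nu>. \<nu> \<in> down_closure ?VY (?f ` C)) F"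
        and lim: "limitin ?VY (\<lambda>\<nu>. \<nu>) \<nu> F"
      define m where "m \<nu> = (SOME \<mu>. \<mu> \<in> C \<and> spec_le ?VY \<nu> (?f \<mu>))" for \<nu>
      have m: "m \<nu> \<in> C \<and> spec_le ?VY \<nu> (?f (m \<nu>))" if "\<nu> \<in> down_closure ?VY (?f ` C)" for \<nu>
      proof -
        have "\<exists>\<mu>. \<mu> \<in> C \<and> spec_le ?VY \<nu> (?f \<mu>)"
          using that by (auto simp: down_closure_def)
        then show ?thesis unfolding m_def by (rule someI_ex)
      qed
      have mC: "eventually (\<lambda>\<nu>. m \<nu> \<in> C) F" using ev by (rule eventually_mono) (use m in blast)
      have "eventually (\<lambda>\<nu>. m \<nu> \<in> topspace ?VX \<and> spec_le ?VY \<nu> (?f (m \<nu>))) F"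
        using ev by (rule eventually_mono) (use m closedin_subset[OF C] in blast)
      then obtain \<mu> where \<mu>: "limitin ?VX m \<mu> F" "spec_le ?VY \<nu> (?f \<mu>)"
        by (rule valuation_map_ultralimit[OF F r lim])
      have "\<mu> \<in> C"
        by (rule limitin_closedin[OF \<mu>(1) C mC]) (use F in \<open>simp add: ultrafilter_def\<close>)
      then show "\<nu> \<in> down_closure ?VY (?f ` C)" using \<mu>(2) by (auto simp: down_closure_def)
    qed
  next
    fix Q assume Q: "compactin ?VY Q \<and> saturatedin ?VY Q"
    show "compactin ?VX {\<mu> \<in> topspace ?VX. ?f \<mu> \<in> Q}"
    proof (rule compactin_if_ultrafilter_limits)
      fix F assume F: "ultrafilter F" and ev: "eventually (\<lambda>\<mu>. \<mu> \<in> {\<mu> \<in> topspace ?VX. ?f \<mu> \<in> Q}) F"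
      have "eventually (\<lambda>\<mu>. ?f \<mu> \<in> Q) F" using ev by (rule eventually_mono) auto
      then obtain \<nu> where \<nu>: "\<nu> \<in> Q" "limitin ?VY ?f \<nu> F"
        using Q F by (blast intro: compactin_imp_ultrafilter_limit)
      have "eventually (\<lambda>\<mu>. \<mu> \<in> topspace ?VX \<and> spec_le ?VY (?f \<mu>) (?f \<mu>)) F"
        using ev by (rule eventually_mono)
          (use valuation_map_in_topspace[OF r_cont] in \<open>auto simp: spec_le_def\<close>)
      then obtain \<mu> where \<mu>: "limitin ?VX (\<lambda>\<mu>. \<mu>) \<mu> F" "spec_le ?VY \<nu> (?f \<mu>)"
        by (rule valuation_map_ultralimit[OF F r \<nu>(2)])
      have "?f \<mu> \<in> Q" using Q \<nu>(1) \<mu>(2) unfolding saturatedin_def by blast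
      then show "\<exists>\<mu>\<in>{\<mu> \<in> topspace ?VX. ?f \<mu> \<in> Q}. limitin ?VX (\<lambda>\<mu>. \<mu>) \<mu> F"
        using \<mu>(1) by (intro bexI[of _ \<mu>]) (auto simp: limitin_def)
    qed auto
    have mono: "spec_le ?VY (?f \<mu>) (?f \<mu>')" if "spec_le ?VX \<mu> \<mu>'" for \<mu> \<mu>'
      using that valuation_map_in_topspace[OF r_cont]
      by (auto simp: spec_le_mass_space valuation_map_def openin_continuous_map_preimage[OF r_cont])
    show "saturatedin ?VX {\<mu> \<in> topspace ?VX. ?f \<mu> \<in> Q}"
      unfolding saturatedin_def
    proof (intro conjI ballI allI impI)
      fix \<mu> \<mu>' assume \<mu>: "\<mu> \<in> {\<mu> \<in> topspace ?VX. ?f \<mu> \<in> Q}" and le: "spec_le ?VX \<mu> \<mu>'"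
      have "?f \<mu>' \<in> Q" using mono[OF le] \<mu> Q by (auto simp: saturatedin_def)
      then show "\<mu>' \<in> {\<mu> \<in> topspace ?VX. ?f \<mu> \<in> Q}" using le by (simp add: spec_le_def)
    qed auto
  }
qed

lemma valuation_spaces_eq_mass_space:
  "valuation_space X = mass_space {0..top} X"
  "subprob_valuation_space X = mass_space {0..1} X"
  "prob_valuation_space X = mass_space {1..1} X"
  by (auto simp: mass_space_def subprob_valuation_space_def prob_valuation_space_def)

theorem theorem12p11:
  fixes X :: "'a topology" and Y :: "'b topology" and r :: "'a \<Rightarrow> 'b"
  assumes "proper_cont_map X Y r"
  shows "proper_cont_map (valuation_space X) (valuation_space Y) (valuation_map X Y r)
    \<and> proper_cont_map (subprob_valuation_space X) (subprob_valuation_space Y) (valuation_map X Y r)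
    \<and> proper_cont_map (prob_valuation_space X) (prob_valuation_space Y) (valuation_map X Y r)"
  unfolding valuation_spaces_eq_mass_space
  by (intro conjI proper_valuation_map assms)

end
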